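(* Let $k$ be a field of characteristic zero, let $\mathcal{L}^1$ be the Connes-Kreimer Lie algebra of rooted trees over $k$, and let $A$ be the Grossman-Larson Hopf algebra of rooted trees over $k$, with Lie algebra of primitive elements $P(A)$. Then the Lie algebras $\mathcal{L}^1$ and $P(A)$ are isomorphic; hence $A$ is isomorphic to the universal enveloping algebra $U(\mathcal{L}^1)$ as Hopf algebras.
   Context: All algebras, linear spaces and tensor products are over $k$. A rooted tree is a finite, connected and simply-connected set of oriented edges and vertices with exactly one distinguished vertex with no incoming edges, the root; edges are oriented away from the root, and trees are considered up to isomorphism (no ordering of children, no labels). The children of a vertex $v$ are the endpoints of the edges outgoing from $v$. All trees are non-empty; $e$ denotes the rooted tree with only one vertex. The Lie algebra $\mathcal{L}^1$: the vector space with basis $\{Z_t\}$ indexed by all rooted trees $t$. Cutting a rooted tree $t$ at one chosen edge (an admissible cut $c$ with $|c|=1$) yields two rooted trees: the trunk, which contains the root of $t$, and the cut branch, which is the other component (rooted at the endpoint of the cut edge farther from the root of $t$). Define the bilinear (non-associative) operation $Z_{t_1}*Z_{t_2}=\sum_t n(t_1,t_2;t)Z_t$, where $n(t_1,t_2;t)$ is the number of edges of $t$ such that cutting there gives cut branch $t_1$ and trunk $t_2$. The Lie bracket is $[Z_{t_1},Z_{t_2}]=Z_{t_1}*Z_{t_2}-Z_{t_2}*Z_{t_1}$ (it is known that this is a Lie bracket). The Hopf algebra $A$: as a vector space it has a basis consisting of all rooted trees. The unit is $e$. Product: for rooted trees $t_1,t_2$, let $s_1,\dots,s_r$ be the children of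 the root of $t_1$ and $n$ the number of vertices of $t_2$; there are $n^r$ ways to attach the $r$ subtrees of $t_1$ with roots $s_1,\dots,s_r$ to $t_2$ by making each $s_i$ a child of some vertex of $t_2$ (the root of the result being the root of $t_2$); $t_1t_2$ is the sum of these $n^r$ rooted trees (with multiplicity). Coproduct: if $t$ is a rooted tree whose root has children $s_1,\dots,s_r$, then $\Delta(t)$ is the sum of the $2^r$ terms $t_1\otimes t_2$, where the children of the root of $t_1$ and the children of the root of $t_2$ (together with the subtrees they carry) range over all $2^r$ ordered partitions of $\{s_1,\dots,s_r\}$ into two (possibly empty) subsets; $\Delta(e)=e\otimes e$. Counit: $\varepsilon(e)=1$, $\varepsilon(t)=0$ for $t\neq e$. It is known that $A$ is a graded connected cocommutative Hopf algebra, the degree $n$ component having as basis the trees with $n+1$ vertices. $P(A)=\{a\in A : \Delta(a)=e\otimes a+a\otimes e\}$ is a Lie algebra under the commutator $[a,b]=ab-ba$; it is known that $P(A)$ has as basis the rooted trees whose root has exactly one child. $U(\mathcal{L}^1)$ carries its usual Hopf algebra structure. *)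

theory Defs
  imports Complex_Main "HOL-Library.Multiset" "HOL-Library.Poly_Mapping" "HOL-Library.Product_Plus"
begin

section \<open>Rooted trees\<close>

text \<open>An isomorphism class of (unordered, unlabelled) rooted trees is determined by the multiset
  of the rooted trees carried by the children of its root.\<close>

datatype rtree = Node (children: "rtree multiset")

abbreviation single_vertex :: rtree ("\<e>")
  where "\<e> \<equiv> Node {#}"

text \<open>\<open>cuts t\<close> is the multiset of pairs (cut branch, trunk), with one entry for each edge of \<open>t\<close>:
  the edge is either the one from the root to a child \<open>s\<close>, or it lies inside the subtree carried by
  a child \<open>s\<close>, and then the trunk of the cut of \<open>s\<close> takes the place of \<open>s\<close>.\<close>

primrec cuts :: "rtree \<Rightarrow> (rtree \<times> rtree) multiset" where
  "cuts (Node M) =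
     (\<Sum>(s, C) \<in># image_mset (\<lambda>s. (s, cuts s)) M.
        add_mset (s, Node (M - {#s#}))
          (image_mset (\<lambda>(b, u). (b, Node (add_mset u (M - {#s#})))) C))"

definition cut_number :: "rtree \<Rightarrow> rtree \<Rightarrow> rtree \<Rightarrow> nat"
  where "cut_number t1 t2 t = count (cuts t) (t1, t2)"

text \<open>To attach several trees simultaneously to the vertices of one tree, each vertex of the latter
  is decorated by the multiset of the trees that are to be attached to it.\<close>

datatype dtree = DNode "rtree multiset" "dtree multiset"

primrec undecorated :: "rtree \<Rightarrow> dtree" where
  "undecorated (Node M) = DNode {#} (image_mset undecorated M)"

text \<open>\<open>place s d\<close> has one entry for each vertex of \<open>d\<close>: the tree \<open>s\<close> is added to the decoration of
  that vertex.\<close>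

primrec place :: "rtree \<Rightarrow> dtree \<Rightarrow> dtree multiset" where
  "place s (DNode D F) =
     add_mset (DNode (add_mset s D) F)
       (\<Sum>(f, P) \<in># image_mset (\<lambda>f. (f, place s f)) F.
          image_mset (\<lambda>f'. DNode D (add_mset f' (F - {#f#}))) P)"

primrec attach_decorations :: "dtree \<Rightarrow> rtree" where
  "attach_decorations (DNode D F) = Node (D + image_mset attach_decorations F)"

definition placements :: "rtree multiset \<Rightarrow> rtree \<Rightarrow> dtree multiset" where
  "placements M t = fold_mset (\<lambda>s Ds. \<Sum>d \<in># Ds. place s d) {#undecorated t#} M"

definition gl_products :: "rtree \<Rightarrow> rtree \<Rightarrow> rtree multiset" where
  "gl_products t1 t2 = image_mset attach_decorations (placements (children t1) t2)"

definition ordered_splits :: "'a multiset \<Rightarrow> ('a multiset \<times> 'a multiset) multiset" where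
  "ordered_splits M =
     fold_mset (\<lambda>s P. image_mset (\<lambda>(l, r). (add_mset s l, r)) P + image_mset (\<lambda>(l, r). (l, add_mset s r)) P)
       {#({#}, {#})#} M"

lemma cuts_Node:
  "cuts (Node M) =
     (\<Sum>s \<in># M. add_mset (s, Node (M - {#s#}))
        (image_mset (\<lambda>(b, u). (b, Node (add_mset u (M - {#s#})))) (cuts s)))"
  by (simp add: image_mset.compositionality comp_def)

lemma place_DNode:
  "place s (DNode D F) =
     add_mset (DNode (add_mset s D) F)
       (\<Sum>f \<in># F. image_mset (\<lambda>f'. DNode D (add_mset f' (F - {#f#}))) (place s f))"
  by (simp add: image_mset.compositionality comp_def)

lemma image_mset_sum_mset:
  "image_mset f (\<Sum>x \<in># M. g x) = (\<Sum>x \<in># M. image_mset f (g x))"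
  by (induction M) auto

lemma place_commute:
  "(\<Sum>d' \<in># place s d. place s' d') = (\<Sum>d' \<in># place s' d. place s d')"
proof (induction d)
  case (DNode D F)
  define G where "G s F = (\<Sum>f \<in># F. image_mset (\<lambda>f'. add_mset f' (F - {#f#})) (place s f))" for s F
  have place_G: "place s (DNode D F) = add_mset (DNode (add_mset s D) F) (image_mset (DNode D) (G s F))"
    for s D F
    by (simp add: place_DNode G_def image_mset_sum_mset image_mset.compositionality comp_def del: place.simps)
  have G_add: "G s (add_mset f F) = image_mset (\<lambda>f'. add_mset f' F) (place s f) + image_mset (add_mset f) (G s F)"
    for s f F
  proof -
    have "(\<Sum>g \<in># F. image_mset (\<lambda>f'. add_mset f' (add_mset f F - {#g#})) (place s g)) =
        (\<Sum>g \<in># F. image_mset (\<lambda>f'. add_mset f (add_mset f' (F - {#g#}))) (place s g))"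
      by (intro arg_cong[where f = sum_mset] image_mset_cong) (auto simp: add_mset_commute)
    then show ?thesis
      by (simp add: G_def image_mset_sum_mset image_mset.compositionality comp_def)
  qed
  have sum_add: "(\<Sum>F \<in># Q. add_mset (h F) (k F)) = image_mset h Q + (\<Sum>F \<in># Q. k F)"
    for Q :: "dtree multiset multiset" and h :: "_ \<Rightarrow> 'b" and k
    by (induction Q) auto
  have swap: "(\<Sum>f \<in># P. image_mset (add_mset f) Q) = (\<Sum>F \<in># Q. image_mset (\<lambda>f. add_mset f F) P)"
    for P :: "dtree multiset" and Q
    by (induction P) (auto simp: sum_add)
  have "(\<Sum>F' \<in># G s F. G s' F') = (\<Sum>F' \<in># G s' F. G s F')"
    if "\<forall>f\<in>#F. (\<Sum>d' \<in># place s f. place s' d') = (\<Sum>d' \<in># place s' f. place s d')" for F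
    using that
  proof (induction F)
    case empty
    then show ?case by (simp add: G_def)
  next
    case (add f F)
    have "(\<Sum>d' \<in># place s f. image_mset (\<lambda>f'. add_mset f' F) (place s' d')) =
        (\<Sum>d' \<in># place s' f. image_mset (\<lambda>f'. add_mset f' F) (place s d'))"
    proof -
      have "(\<Sum>d' \<in># place s f. place s' d') = (\<Sum>d' \<in># place s' f. place s d')"
        using add.prems by simp
      from arg_cong[OF this, of "image_mset (\<lambda>f'. add_mset f' F)"] show ?thesis
        by (simp add: image_mset_sum_mset image_mset.compositionality comp_def)
    qed
    moreover have "(\<Sum>F' \<in># G s F. image_mset (add_mset f) (G s' F')) =
        (\<Sum>F' \<in># G s' F. image_mset (add_mset f) (G s F'))"
    proof -
      have "(\<Sum>F' \<in># G s F. G s' F') = (\<Sum>F' \<in># G s' F. G s F')"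
        using add by simp
      from arg_cong[OF this, of "image_mset (add_mset f)"] show ?thesis
        by (simp add: image_mset_sum_mset image_mset.compositionality comp_def)
    qed
    ultimately show ?case
      using add.prems by (simp add: G_add image_mset.compositionality comp_def sum_mset.distrib swap)
  qed
  then have "(\<Sum>F' \<in># G s F. G s' F') = (\<Sum>F' \<in># G s' F. G s F')"
    using DNode by blast
  from arg_cong[OF this, of "image_mset (DNode D)"]
  have "(\<Sum>F' \<in># G s F. image_mset (DNode D) (G s' F')) = (\<Sum>F' \<in># G s' F. image_mset (DNode D) (G s F'))"
    by (simp add: image_mset_sum_mset image_mset.compositionality comp_def)
  then show ?case
    by (simp add: place_G sum_add image_mset.compositionality comp_def add_mset_commute del: place.simps)
qed

lemma placements_empty: "placements {#} t = {#undecorated t#}"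
  by (simp add: placements_def)

lemma placements_add_mset: "placements (add_mset s M) t = (\<Sum>d \<in># placements M t. place s d)"
proof -
  interpret comp_fun_commute "\<lambda>s Ds. \<Sum>d \<in># Ds. place s d"
  proof
    have *: "(\<Sum>d \<in># (\<Sum>d \<in># Ds. place s d). place s' d) = (\<Sum>d \<in># Ds. \<Sum>d' \<in># place s d. place s' d')" for s s' Ds
      by (induction Ds) auto
    show "(\<lambda>Ds. \<Sum>d \<in># Ds. place s' d) \<circ> (\<lambda>Ds. \<Sum>d \<in># Ds. place s d) =
        (\<lambda>Ds. \<Sum>d \<in># Ds. place s d) \<circ> (\<lambda>Ds. \<Sum>d \<in># Ds. place s' d)" for s s'
      by (rule ext) (simp add: * place_commute[where s = s and s' = s'])
  qed
  show ?thesis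
    by (simp add: placements_def fold_mset_add_mset)
qed

lemma ordered_splits_empty: "ordered_splits {#} = {#({#}, {#})#}"
  by (simp add: ordered_splits_def)

lemma ordered_splits_add_mset:
  "ordered_splits (add_mset s M) =
     image_mset (\<lambda>(l, r). (add_mset s l, r)) (ordered_splits M) +
     image_mset (\<lambda>(l, r). (l, add_mset s r)) (ordered_splits M)"
proof -
  interpret comp_fun_commute
    "\<lambda>s :: 'a. \<lambda>P. image_mset (\<lambda>(l, r). (add_mset s l, r)) P + image_mset (\<lambda>(l, r). (l, add_mset s r)) P"
    by standard (auto simp: fun_eq_iff image_mset.compositionality comp_def case_prod_unfold add_mset_commute)
  show ?thesis
    by (simp add: ordered_splits_def fold_mset_add_mset)
qed

primrec vertices :: "rtree \<Rightarrow> nat" where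
  "vertices (Node M) = Suc (sum_mset (image_mset vertices M))"

lemma sum_vertices_remove:
  "s \<in># M \<Longrightarrow> sum_mset (image_mset vertices M) = vertices s + sum_mset (image_mset vertices (M - {#s#}))"
  by (metis image_mset_add_mset insert_DiffM sum_mset.insert)

lemma vertices_cuts: "(b, u) \<in># cuts t \<Longrightarrow> vertices b + vertices u = vertices t"
proof (induction t arbitrary: b u)
  case (Node M)
  then obtain s where s: "s \<in># M" and
    "(b, u) = (s, Node (M - {#s#})) \<or> (\<exists>v. (b, v) \<in># cuts s \<and> u = Node (add_mset v (M - {#s#})))"
    unfolding cuts_Node by auto
  then consider "b = s" "u = Node (M - {#s#})"
    | v where "(b, v) \<in># cuts s" "u = Node (add_mset v (M - {#s#}))"
    by blast
  then show ?case
  proof cases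
    case 1
    then show ?thesis by (simp add: sum_vertices_remove[OF s])
  next
    case 2
    then show ?thesis using Node.IH[OF s 2(1)] by (simp add: sum_vertices_remove[OF s])
  qed
qed

lemma finite_vertices: "finite {t. vertices t \<le> n}"
proof (induction n)
  case 0
  have "vertices t \<noteq> 0" for t by (cases t) simp
  then have "{t. vertices t \<le> 0} = {}" by blast
  then show ?case by (simp only: finite.emptyI)
next
  case (Suc n)
  have "{t. vertices t \<le> Suc n} \<subseteq> Node ` (\<Union>m \<in> {..n}. multisets_of_size {t. vertices t \<le> n} m)"
  proof
    fix t assume t: "t \<in> {t. vertices t \<le> Suc n}"
    obtain M where M: "t = Node M" by (cases t)
    then have le: "sum_mset (image_mset vertices M) \<le> n" using t by simp
    have "size M \<le> sum_mset (image_mset vertices M)"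
    proof (induction M)
      case (add x M)
      have "vertices x > 0" by (cases x) simp
      with add show ?case by simp
    qed simp
    then have "size M \<le> n" using le by (rule order_trans)
    moreover have "vertices s \<le> n" if "s \<in># M" for s
      using le sum_vertices_remove[OF that] by linarith
    ultimately show "t \<in> Node ` (\<Union>m \<in> {..n}. multisets_of_size {t. vertices t \<le> n} m)"
      unfolding M by (intro imageI UN_I[of "size M"]) (auto simp: multisets_of_size_def)
  qed
  then show ?case
    by (rule finite_subset) (intro finite_imageI finite_UN_I finite_atMost finite_multisets_of_size Suc)
qed

lemma finite_cut_number: "finite {t. cut_number t1 t2 t \<noteq> 0}"
proof (rule finite_subset[OF _ finite_vertices])
  show "{t. cut_number t1 t2 t \<noteq> 0} \<subseteq> {t. vertices t \<le> vertices t1 + vertices t2}"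
    using vertices_cuts by (auto simp: cut_number_def count_eq_zero_iff)
qed

section \<open>Spaces with a basis\<close>

text \<open>The vector space with basis \<open>'a\<close> over \<open>'k\<close> is \<open>'a \<Rightarrow>\<^sub>0 'k\<close>.\<close>

definition pscale :: "'k::semiring_0 \<Rightarrow> ('a \<Rightarrow>\<^sub>0 'k) \<Rightarrow> ('a \<Rightarrow>\<^sub>0 'k)"
  where "pscale c p = Poly_Mapping.map ((*) c) p"

definition bas :: "'a \<Rightarrow> ('a \<Rightarrow>\<^sub>0 'k::zero_neq_one)"
  where "bas x = Poly_Mapping.single x 1"

definition lin_ext :: "('a \<Rightarrow> ('b \<Rightarrow>\<^sub>0 'k::semiring_0)) \<Rightarrow> ('a \<Rightarrow>\<^sub>0 'k) \<Rightarrow> ('b \<Rightarrow>\<^sub>0 'k)"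
  where "lin_ext f p = (\<Sum>x \<in> Poly_Mapping.keys p. pscale (Poly_Mapping.lookup p x) (f x))"

definition bilin_ext ::
    "('a \<Rightarrow> 'b \<Rightarrow> ('c \<Rightarrow>\<^sub>0 'k::semiring_0)) \<Rightarrow> ('a \<Rightarrow>\<^sub>0 'k) \<Rightarrow> ('b \<Rightarrow>\<^sub>0 'k) \<Rightarrow> ('c \<Rightarrow>\<^sub>0 'k)"
  where "bilin_ext f p q = lin_ext (\<lambda>x. lin_ext (f x) q) p"

lemma lookup_pscale [simp]: "Poly_Mapping.lookup (pscale c p) x = c * Poly_Mapping.lookup p x"
  by (simp add: pscale_def Poly_Mapping.map.rep_eq when_def)

lemma lookup_bas: "Poly_Mapping.lookup (bas x) y = (if x = y then 1 else 0)"
  by (simp add: bas_def Poly_Mapping.lookup_single when_def)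

global_interpretation pscale: vector_space "pscale :: 'k::field \<Rightarrow> ('a \<Rightarrow>\<^sub>0 'k) \<Rightarrow> _"
  by standard (auto intro!: poly_mapping_eqI simp: lookup_add algebra_simps)

lemma lin_ext_superset:
  fixes f :: "'a \<Rightarrow> ('b \<Rightarrow>\<^sub>0 'k::semiring_0)"
  assumes "finite A" "Poly_Mapping.keys p \<subseteq> A"
  shows "lin_ext f p = (\<Sum>x\<in>A. pscale (Poly_Mapping.lookup p x) (f x))"
  unfolding lin_ext_def
proof (rule sum.mono_neutral_left[OF assms])
  have "pscale 0 q = 0" for q :: "'b \<Rightarrow>\<^sub>0 'k"
    by (rule poly_mapping_eqI) simp
  then show "\<forall>x\<in>A - Poly_Mapping.keys p. pscale (Poly_Mapping.lookup p x) (f x) = 0"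
    by (auto simp: in_keys_iff)
qed

lemma lin_ext_add: "lin_ext f (p + q) = lin_ext f p + lin_ext f q"
  for f :: "_ \<Rightarrow> (_ \<Rightarrow>\<^sub>0 'k::field)"
proof -
  let ?A = "Poly_Mapping.keys p \<union> Poly_Mapping.keys q"
  have "finite ?A" "Poly_Mapping.keys (p + q) \<subseteq> ?A"
    by (auto simp: Poly_Mapping.keys_add)
  then show ?thesis
    by (simp add: lin_ext_superset[of ?A] lookup_add pscale.scale_left_distrib sum.distrib)
qed

lemma lin_ext_scale: "lin_ext f (pscale c p) = pscale c (lin_ext f p)"
  for f :: "_ \<Rightarrow> (_ \<Rightarrow>\<^sub>0 'k::field)"
proof -
  have "Poly_Mapping.keys (pscale c p) \<subseteq> Poly_Mapping.keys p"
    by (auto simp: in_keys_iff)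
  then show ?thesis
    by (simp add: lin_ext_superset[of "Poly_Mapping.keys p"] pscale.scale_sum_right)
qed

lemma lin_ext_bas [simp]: "lin_ext f (bas x) = f x"
  for f :: "_ \<Rightarrow> (_ \<Rightarrow>\<^sub>0 'k::field)"
  by (simp add: lin_ext_superset[of "{x}"] bas_def)

lemma lin_ext_0 [simp]: "lin_ext f 0 = 0"
  by (simp add: lin_ext_def)

lemma lin_ext_diff: "lin_ext f (p - q) = lin_ext f p - lin_ext f q"
  for f :: "_ \<Rightarrow> (_ \<Rightarrow>\<^sub>0 'k::field)"
  by (metis add_diff_cancel diff_add_cancel lin_ext_add)

lemma basis_induct [case_names zero add scale]:
  fixes p :: "'a \<Rightarrow>\<^sub>0 'k::field"
  assumes "P 0" "\<And>p q. P p \<Longrightarrow> P q \<Longrightarrow> P (p + q)" "\<And>c x. P (pscale c (bas x))"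
  shows "P p"
proof -
  have "p = (\<Sum>x\<in>Poly_Mapping.keys p. pscale (Poly_Mapping.lookup p x) (bas x))"
    by (rule poly_mapping_eqI) (auto simp: lookup_sum lookup_bas in_keys_iff if_distrib[of "(*) _"] sum.delta cong: if_cong)
  moreover have "P (\<Sum>x\<in>A. pscale (c x) (bas x))" if "finite A" for A c
    using that by (induction A) (auto intro: assms)
  ultimately show ?thesis by (metis finite_keys)
qed


section \<open>Tensor products\<close>

text \<open>The tensor product of two spaces is the free vector space on the pairs of vectors modulo the
  bilinearity relations. Its elements are represented as cosets.\<close>

definition bilinearity_relations ::
    "('k::field \<Rightarrow> 'v::ab_group_add \<Rightarrow> 'v) \<Rightarrow> ('k \<Rightarrow> 'w::ab_group_add \<Rightarrow> 'w) \<Rightarrow> ('v \<times> 'w \<Rightarrow>\<^sub>0 'k) set" where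
  "bilinearity_relations s1 s2 =
     {bas (v + v', w) - bas (v, w) - bas (v', w) | v v' w. True} \<union>
     {bas (v, w + w') - bas (v, w) - bas (v, w') | v w w'. True} \<union>
     {bas (s1 c v, w) - pscale c (bas (v, w)) | c v w. True} \<union>
     {bas (v, s2 c w) - pscale c (bas (v, w)) | c v w. True}"

definition tensor_class ::
    "('k::field \<Rightarrow> 'v::ab_group_add \<Rightarrow> 'v) \<Rightarrow> ('k \<Rightarrow> 'w::ab_group_add \<Rightarrow> 'w) \<Rightarrow>
     ('v \<times> 'w \<Rightarrow>\<^sub>0 'k) \<Rightarrow> ('v \<times> 'w \<Rightarrow>\<^sub>0 'k) set" where
  "tensor_class s1 s2 p = {q. q - p \<in> pscale.span (bilinearity_relations s1 s2)}"

lemma bilinearity_relations_cases: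
  assumes "r \<in> bilinearity_relations s1 s2"
  obtains v v' w where "r = bas (v + v', w) - bas (v, w) - bas (v', w)"
    | v w w' where "r = bas (v, w + w') - bas (v, w) - bas (v, w')"
    | c v w where "r = bas (s1 c v, w) - pscale c (bas (v, w))"
    | c v w where "r = bas (v, s2 c w) - pscale c (bas (v, w))"
  using assms by (auto simp: bilinearity_relations_def)

lemma tensor_class_eq_iff:
  "tensor_class s1 s2 p = tensor_class s1 s2 q \<longleftrightarrow> p - q \<in> pscale.span (bilinearity_relations s1 s2)"
proof
  assume "tensor_class s1 s2 p = tensor_class s1 s2 q"
  moreover have "p \<in> tensor_class s1 s2 p"
    by (simp add: tensor_class_def pscale.span_zero)
  ultimately show "p - q \<in> pscale.span (bilinearity_relations s1 s2)"
    by (simp add: tensor_class_def)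
next
  assume *: "p - q \<in> pscale.span (bilinearity_relations s1 s2)"
  have "r - p \<in> pscale.span (bilinearity_relations s1 s2) \<longleftrightarrow> r - q \<in> pscale.span (bilinearity_relations s1 s2)" for r
    using pscale.span_add[OF _ *, of "r - p"] pscale.span_diff[OF _ *, of "r - q"] by auto
  then show "tensor_class s1 s2 p = tensor_class s1 s2 q"
    by (simp add: tensor_class_def)
qed


section \<open>Lie algebras and Hopf algebras\<close>

record ('k, 'l) lie_data =
  lcarrier :: "'l set"
  lscale :: "'k \<Rightarrow> 'l \<Rightarrow> 'l"
  lbracket :: "'l \<Rightarrow> 'l \<Rightarrow> 'l"

definition lie_isomorphism ::
    "('k, 'l::ab_group_add) lie_data \<Rightarrow> ('k, 'm::ab_group_add) lie_data \<Rightarrow> ('l \<Rightarrow> 'm) \<Rightarrow> bool" where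
  "lie_isomorphism L M f \<longleftrightarrow>
     bij_betw f (lcarrier L) (lcarrier M) \<and>
     (\<forall>x\<in>lcarrier L. \<forall>y\<in>lcarrier L. f (x + y) = f x + f y) \<and>
     (\<forall>c. \<forall>x\<in>lcarrier L. f (lscale L c x) = lscale M c (f x)) \<and>
     (\<forall>x\<in>lcarrier L. \<forall>y\<in>lcarrier L. f (lbracket L x y) = lbracket M (f x) (f y))"

definition lie_isomorphic ::
    "('k, 'l::ab_group_add) lie_data \<Rightarrow> ('k, 'm::ab_group_add) lie_data \<Rightarrow> bool" where
  "lie_isomorphic L M \<longleftrightarrow> (\<exists>f. lie_isomorphism L M f)"

text \<open>The antipode of a Hopf algebra is determined by the other operations, and an isomorphism of the
  underlying bialgebras automatically commutes with the antipodes, so it is not recorded.\<close>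

record (overloaded) ('k::zero, 'a) hopf_data =
  hscale :: "'k \<Rightarrow> 'a \<Rightarrow> 'a"
  hmult :: "'a \<Rightarrow> 'a \<Rightarrow> 'a"
  hunit :: 'a
  hcomult :: "'a \<Rightarrow> ('a \<times> 'a \<Rightarrow>\<^sub>0 'k) set"
  hcounit :: "'a \<Rightarrow> 'k"

abbreviation tensor_class2 ::
    "('k::field, 'a::ab_group_add) hopf_data \<Rightarrow> ('a \<times> 'a \<Rightarrow>\<^sub>0 'k) \<Rightarrow> ('a \<times> 'a \<Rightarrow>\<^sub>0 'k) set" where
  "tensor_class2 H \<equiv> tensor_class (hscale H) (hscale H)"

text \<open>\<open>f \<otimes> f\<close> on the tensor square; for linear \<open>f\<close> all the cosets in the union coincide.\<close>

definition tensor_map2 ::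
    "('k::field, 'b::ab_group_add) hopf_data \<Rightarrow> ('a \<Rightarrow> 'b) \<Rightarrow> ('a \<times> 'a \<Rightarrow>\<^sub>0 'k) set \<Rightarrow> ('b \<times> 'b \<Rightarrow>\<^sub>0 'k) set" where
  "tensor_map2 K f X = (\<Union>p\<in>X. tensor_class2 K (lin_ext (\<lambda>(x, y). bas (f x, f y)) p))"

definition hopf_isomorphism ::
    "('k::field, 'a::ab_group_add) hopf_data \<Rightarrow> ('k, 'b::ab_group_add) hopf_data \<Rightarrow> ('a \<Rightarrow> 'b) \<Rightarrow> bool" where
  "hopf_isomorphism H K f \<longleftrightarrow>
     bij f \<and>
     (\<forall>x y. f (x + y) = f x + f y) \<and>
     (\<forall>c x. f (hscale H c x) = hscale K c (f x)) \<and>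
     (\<forall>x y. f (hmult H x y) = hmult K (f x) (f y)) \<and>
     f (hunit H) = hunit K \<and>
     (\<forall>x. hcomult K (f x) = tensor_map2 K f (hcomult H x)) \<and>
     (\<forall>x. hcounit K (f x) = hcounit H x)"

definition hopf_isomorphic ::
    "('k::field, 'a::ab_group_add) hopf_data \<Rightarrow> ('k, 'b::ab_group_add) hopf_data \<Rightarrow> bool" where
  "hopf_isomorphic H K \<longleftrightarrow> (\<exists>f. hopf_isomorphism H K f)"

definition primitives :: "('k::field, 'a::ab_group_add) hopf_data \<Rightarrow> 'a set" where
  "primitives H =
     {a. hcomult H a = tensor_class2 H (bas (hunit H, a) + bas (a, hunit H))}"

definition primitive_lie :: "('k::field, 'a::ab_group_add) hopf_data \<Rightarrow> ('k, 'a) lie_data" where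
  "primitive_lie H =
     \<lparr>lcarrier = primitives H, lscale = hscale H, lbracket = (\<lambda>a b. hmult H a b - hmult H b a)\<rparr>"


section \<open>The Connes-Kreimer Lie algebra and the Grossman-Larson Hopf algebra\<close>

type_synonym 'k tree_space = "rtree \<Rightarrow>\<^sub>0 'k"

definition ck_star :: "'k::field tree_space \<Rightarrow> 'k tree_space \<Rightarrow> 'k tree_space" where
  "ck_star = bilin_ext (\<lambda>t1 t2. \<Sum>t | cut_number t1 t2 t \<noteq> 0. pscale (of_nat (cut_number t1 t2 t)) (bas t))"

definition ck_bracket :: "'k::field tree_space \<Rightarrow> 'k tree_space \<Rightarrow> 'k tree_space" where
  "ck_bracket x y = ck_star x y - ck_star y x"

definition ck_lie :: "('k::field, 'k tree_space) lie_data" where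
  "ck_lie = \<lparr>lcarrier = UNIV, lscale = pscale, lbracket = ck_bracket\<rparr>"

definition gl_mult :: "'k::field tree_space \<Rightarrow> 'k tree_space \<Rightarrow> 'k tree_space" where
  "gl_mult = bilin_ext (\<lambda>t1 t2. \<Sum>t \<in># gl_products t1 t2. bas t)"

definition gl_comult :: "'k::field tree_space \<Rightarrow> ('k tree_space \<times> 'k tree_space \<Rightarrow>\<^sub>0 'k) set" where
  "gl_comult a =
     tensor_class pscale pscale
       (lin_ext (\<lambda>t. \<Sum>(l, r) \<in># ordered_splits (children t). bas (bas (Node l), bas (Node r))) a)"

definition gl_hopf :: "('k::field, 'k tree_space) hopf_data" where
  "gl_hopf =
     \<lparr>hscale = pscale, hmult = gl_mult, hunit = bas \<e>, hcomult = gl_comult,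
      hcounit = (\<lambda>a. Poly_Mapping.lookup a \<e>)\<rparr>"


section \<open>The universal enveloping algebra\<close>

text \<open>With concatenation of words as addition, \<open>'a list \<Rightarrow>\<^sub>0 'k\<close> carries the product of the free
  associative algebra on \<open>'a\<close>, and \<open>'a list \<times> 'a list \<Rightarrow>\<^sub>0 'k\<close> the product of its tensor square.\<close>

instantiation list :: (type) monoid_add
begin

definition zero_list :: "'a list" where "zero_list = []"

definition plus_list :: "'a list \<Rightarrow> 'a list \<Rightarrow> 'a list" where "plus_list = (@)"

instance
  by standard (simp_all add: zero_list_def plus_list_def)

end

inductive_set two_sided_ideal :: "'r::ring_1 set \<Rightarrow> 'r set" for S where
  zero: "0 \<in> two_sided_ideal S"
| add: "a \<in> two_sided_ideal S \<Longrightarrow> s \<in> S \<Longrightarrow> a + p * s * q \<in> two_sided_ideal S"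

abbreviation letter :: "'l \<Rightarrow> ('l list \<Rightarrow>\<^sub>0 'k::zero_neq_one)"
  where "letter x \<equiv> bas [x]"

text \<open>The first two families of relations cut the free algebra on the set underlying a Lie algebra
  down to the tensor algebra of the underlying vector space.\<close>

definition enveloping_relations ::
    "('k::field \<Rightarrow> 'l::ab_group_add \<Rightarrow> 'l) \<Rightarrow> ('l \<Rightarrow> 'l \<Rightarrow> 'l) \<Rightarrow> ('l list \<Rightarrow>\<^sub>0 'k) set" where
  "enveloping_relations s br =
     {letter (x + y) - letter x - letter y | x y. True} \<union>
     {letter (s c x) - pscale c (letter x) | c x. True} \<union>
     {letter x * letter y - letter y * letter x - letter (br x y) | x y. True}"

definition enveloping_ideal ::
    "('k::field \<Rightarrow> 'l::ab_group_add \<Rightarrow> 'l) \<Rightarrow> ('l \<Rightarrow> 'l \<Rightarrow> 'l) \<Rightarrow> ('l list \<Rightarrow>\<^sub>0 'k) set" where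
  "enveloping_ideal s br = two_sided_ideal (enveloping_relations s br)"

lemma two_sided_ideal_add:
  assumes "a \<in> two_sided_ideal S" "b \<in> two_sided_ideal S"
  shows "a + b \<in> two_sided_ideal S"
  using assms(2,1) by induction (auto simp: add.assoc[symmetric] intro: two_sided_ideal.add)

lemma two_sided_ideal_mult_left: "a \<in> two_sided_ideal S \<Longrightarrow> r * a \<in> two_sided_ideal S"
proof (induction rule: two_sided_ideal.induct)
  case (add a s p q)
  then show ?case
    using two_sided_ideal.add[of "r * a" S s "r * p" q] by (simp add: distrib_left mult.assoc)
qed (simp add: two_sided_ideal.zero)

lemma two_sided_ideal_mult_right: "a \<in> two_sided_ideal S \<Longrightarrow> a * r \<in> two_sided_ideal S"
proof (induction rule: two_sided_ideal.induct)
  case (add a s p q)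
  then show ?case
    using two_sided_ideal.add[of "a * r" S s p "q * r"] by (simp add: distrib_right mult.assoc)
qed (simp add: two_sided_ideal.zero)

lemma two_sided_ideal_minus: "a \<in> two_sided_ideal S \<Longrightarrow> - a \<in> two_sided_ideal S"
  using two_sided_ideal_mult_left[of a S "- 1"] by simp

lemma two_sided_ideal_generator: "s \<in> S \<Longrightarrow> s \<in> two_sided_ideal S"
  using two_sided_ideal.add[OF two_sided_ideal.zero, of s S 1 1] by simp

lemma pscale_eq_mult: "pscale c p = Poly_Mapping.single 0 c * p"
  by (simp add: pscale_def mult_map_scale_conv_mult)

lemma pscale_commutes: "p * Poly_Mapping.single 0 c = Poly_Mapping.single 0 c * p"
  for p :: "'a::monoid_add \<Rightarrow>\<^sub>0 'k::field"
  by (induction p rule: basis_induct)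
    (auto simp: distrib_left distrib_right pscale_eq_mult bas_def mult_single mult.commute)

definition ck_env_equiv :: "('k::field tree_space list \<Rightarrow>\<^sub>0 'k) \<Rightarrow> ('k tree_space list \<Rightarrow>\<^sub>0 'k) \<Rightarrow> bool"
  where "ck_env_equiv p q \<longleftrightarrow> p - q \<in> enveloping_ideal pscale ck_bracket"

quotient_type (overloaded) 'k ck_env = "'k::field tree_space list \<Rightarrow>\<^sub>0 'k" / ck_env_equiv
proof (rule equivpI)
  show "reflp (ck_env_equiv :: ('k tree_space list \<Rightarrow>\<^sub>0 'k) \<Rightarrow> _)"
    by (auto intro!: reflpI simp: ck_env_equiv_def enveloping_ideal_def two_sided_ideal.zero)
  show "symp (ck_env_equiv :: ('k tree_space list \<Rightarrow>\<^sub>0 'k) \<Rightarrow> _)"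
    by (intro sympI) (metis ck_env_equiv_def enveloping_ideal_def minus_diff_eq two_sided_ideal_minus)
  show "transp (ck_env_equiv :: ('k tree_space list \<Rightarrow>\<^sub>0 'k) \<Rightarrow> _)"
  proof (rule transpI)
    fix p q r :: "'k tree_space list \<Rightarrow>\<^sub>0 'k"
    assume "ck_env_equiv p q" "ck_env_equiv q r"
    then have "(p - q) + (q - r) \<in> enveloping_ideal pscale ck_bracket"
      unfolding ck_env_equiv_def enveloping_ideal_def by (rule two_sided_ideal_add)
    then show "ck_env_equiv p r" by (simp add: ck_env_equiv_def)
  qed
qed

instantiation ck_env :: (field) "{ring, monoid_mult}"
begin

lift_definition zero_ck_env :: "'a ck_env" is 0 .

lift_definition one_ck_env :: "'a ck_env" is 1 .

lift_definition plus_ck_env :: "'a ck_env \<Rightarrow> 'a ck_env \<Rightarrow> 'a ck_env" is "(+)"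
  unfolding ck_env_equiv_def enveloping_ideal_def using two_sided_ideal_add by (metis add_diff_add)

lift_definition uminus_ck_env :: "'a ck_env \<Rightarrow> 'a ck_env" is uminus
  unfolding ck_env_equiv_def enveloping_ideal_def using two_sided_ideal_minus by (metis minus_diff_minus)

lift_definition minus_ck_env :: "'a ck_env \<Rightarrow> 'a ck_env \<Rightarrow> 'a ck_env" is minus
  unfolding ck_env_equiv_def enveloping_ideal_def
proof -
  fix p q r s :: "'a tree_space list \<Rightarrow>\<^sub>0 'a"
  assume "p - q \<in> two_sided_ideal (enveloping_relations pscale ck_bracket)"
    "r - s \<in> two_sided_ideal (enveloping_relations pscale ck_bracket)"
  then have "(p - q) + - (r - s) \<in> two_sided_ideal (enveloping_relations pscale ck_bracket)"
    by (intro two_sided_ideal_add two_sided_ideal_minus)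
  then show "p - r - (q - s) \<in> two_sided_ideal (enveloping_relations pscale ck_bracket)"
    by (simp add: algebra_simps)
qed

lift_definition times_ck_env :: "'a ck_env \<Rightarrow> 'a ck_env \<Rightarrow> 'a ck_env" is times
  unfolding ck_env_equiv_def enveloping_ideal_def
proof -
  fix p q r s :: "'a tree_space list \<Rightarrow>\<^sub>0 'a"
  assume "p - q \<in> two_sided_ideal (enveloping_relations pscale ck_bracket)"
    "r - s \<in> two_sided_ideal (enveloping_relations pscale ck_bracket)"
  then have "(p - q) * r + q * (r - s) \<in> two_sided_ideal (enveloping_relations pscale ck_bracket)"
    by (intro two_sided_ideal_add two_sided_ideal_mult_left two_sided_ideal_mult_right)
  then show "p * r - q * s \<in> two_sided_ideal (enveloping_relations pscale ck_bracket)"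
    by (simp add: algebra_simps)
qed

instance
  by standard (transfer; simp add: ck_env_equiv_def enveloping_ideal_def two_sided_ideal.zero algebra_simps)+

end

lift_definition ck_env_scale :: "'k::field \<Rightarrow> 'k ck_env \<Rightarrow> 'k ck_env" is pscale
  unfolding ck_env_equiv_def enveloping_ideal_def
  by (metis pscale.scale_right_diff_distrib pscale_eq_mult two_sided_ideal_mult_left)

text \<open>The algebra homomorphism into the tensor square of the free algebra under which all letters
  are primitive.\<close>

definition free_comult :: "('l list \<Rightarrow>\<^sub>0 'k::field) \<Rightarrow> ('l list \<times> 'l list \<Rightarrow>\<^sub>0 'k)" where
  "free_comult = lin_ext (\<lambda>w. \<Prod>x\<leftarrow>w. bas ([x], []) + bas ([], [x]))"

definition env_project2 :: "('k::field tree_space list \<times> 'k tree_space list \<Rightarrow>\<^sub>0 'k) \<Rightarrow> ('k ck_env \<times> 'k ck_env \<Rightarrow>\<^sub>0 'k)" where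
  "env_project2 = lin_ext (\<lambda>(u, v). bas (abs_ck_env (bas u), abs_ck_env (bas v)))"

lemma pscale_mult_left: "pscale c p * q = pscale c (p * q)"
  and pscale_mult_right: "p * pscale c q = pscale c (p * q)"
  for p q :: "'a::monoid_add \<Rightarrow>\<^sub>0 'k::field"
  using pscale_commutes[of p c] by (simp_all add: pscale_eq_mult mult.assoc[symmetric])

lemma bas_mult: "bas x * bas y = (bas (x + y) :: 'a::monoid_add \<Rightarrow>\<^sub>0 'k::field)"
  by (simp add: bas_def mult_single)

lemma abs_ck_env_bas_append: "abs_ck_env (bas (u @ v)) = abs_ck_env (bas u) * abs_ck_env (bas v)"
  by (simp add: times_ck_env.abs_eq bas_mult plus_list_def)

lemma abs_ck_env_bas_Nil: "abs_ck_env (bas []) = 1"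
  by (simp add: one_ck_env.abs_eq bas_def flip: zero_list_def)

lemma ck_env_scale_mult_left: "ck_env_scale c a * b = ck_env_scale c (a * b)"
  and ck_env_scale_mult_right: "a * ck_env_scale c b = ck_env_scale c (a * b)"
  by (transfer; simp add: pscale_mult_left pscale_mult_right ck_env_equiv_def enveloping_ideal_def two_sided_ideal.zero)+

lemma ck_env_relations:
  "abs_ck_env (letter (x + y)) = abs_ck_env (letter x) + abs_ck_env (letter y)"
  "abs_ck_env (letter (pscale c x)) = ck_env_scale c (abs_ck_env (letter x))"
  "abs_ck_env (letter x) * abs_ck_env (letter y) =
     abs_ck_env (letter y) * abs_ck_env (letter x) + abs_ck_env (letter (ck_bracket x y))"
  unfolding plus_ck_env.abs_eq times_ck_env.abs_eq ck_env_scale.abs_eq ck_env.abs_eq_iff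
    ck_env_equiv_def enveloping_ideal_def
  by (rule two_sided_ideal_generator; force simp: enveloping_relations_def algebra_simps)+

abbreviation ck_env_tensor_relations :: "('k::field ck_env \<times> 'k ck_env \<Rightarrow>\<^sub>0 'k) set" where
  "ck_env_tensor_relations \<equiv> pscale.span (bilinearity_relations ck_env_scale ck_env_scale)"

lemma ck_env_tensor_relations:
  "bas (v + v', w) - bas (v, w) - bas (v', w) \<in> ck_env_tensor_relations"
  "bas (v, w + w') - bas (v, w) - bas (v, w') \<in> ck_env_tensor_relations"
  "bas (ck_env_scale c v, w) - pscale c (bas (v, w)) \<in> ck_env_tensor_relations"
  "bas (v, ck_env_scale c w) - pscale c (bas (v, w)) \<in> ck_env_tensor_relations"
  by (rule pscale.span_base; force simp: bilinearity_relations_def)+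

lemma ck_env_tensor_relations_lin_ext:
  assumes "\<And>r. r \<in> bilinearity_relations ck_env_scale ck_env_scale \<Longrightarrow> lin_ext f r \<in> ck_env_tensor_relations"
    and "z \<in> ck_env_tensor_relations"
  shows "lin_ext f z \<in> ck_env_tensor_relations"
  using assms(2)
  by (induction rule: pscale.span_induct_alt)
    (auto simp: lin_ext_add lin_ext_scale intro!: pscale.span_zero pscale.span_add pscale.span_scale assms(1))

lemma ck_env_tensor_relations_mult:
  fixes z :: "'k::field ck_env \<times> 'k ck_env \<Rightarrow>\<^sub>0 'k"
  assumes "z \<in> ck_env_tensor_relations"
  shows "lin_ext (\<lambda>(a, b). bas (u * a, v * b)) z \<in> ck_env_tensor_relations"
    and "lin_ext (\<lambda>(a, b). bas (a * u, b * v)) z \<in> ck_env_tensor_relations"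
  by (rule ck_env_tensor_relations_lin_ext[OF _ assms], erule bilinearity_relations_cases;
      simp add: lin_ext_diff lin_ext_scale distrib_left distrib_right ck_env_scale_mult_left
        ck_env_scale_mult_right ck_env_tensor_relations)+

lemma env_project2_mult_bas:
  "env_project2 (bas (u, v) * z) =
     lin_ext (\<lambda>(a, b). bas (abs_ck_env (bas u) * a, abs_ck_env (bas v) * b)) (env_project2 z)"
  "env_project2 (z * bas (u, v)) =
     lin_ext (\<lambda>(a, b). bas (a * abs_ck_env (bas u), b * abs_ck_env (bas v))) (env_project2 z)"
  by (induction z rule: basis_induct)
    (auto simp: env_project2_def lin_ext_add lin_ext_scale distrib_left distrib_right pscale_mult_left
      pscale_mult_right bas_mult plus_list_def abs_ck_env_bas_append case_prod_unfold)

lemma env_project2_mult: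
  fixes p z :: "'k::field tree_space list \<times> 'k tree_space list \<Rightarrow>\<^sub>0 'k"
  assumes "env_project2 z \<in> ck_env_tensor_relations"
  shows "env_project2 (p * z) \<in> ck_env_tensor_relations" "env_project2 (z * p) \<in> ck_env_tensor_relations"
proof -
  have lin: "env_project2 0 = 0" "env_project2 (a + b) = env_project2 a + env_project2 b"
    "env_project2 (pscale c a) = pscale c (env_project2 a)" for a b and c :: 'k
    by (simp_all add: env_project2_def lin_ext_add lin_ext_scale)
  have m: "env_project2 (bas m * z) \<in> ck_env_tensor_relations" "env_project2 (z * bas m) \<in> ck_env_tensor_relations" for m
    using ck_env_tensor_relations_mult[OF assms] by (cases m; simp add: env_project2_mult_bas)+
  show "env_project2 (p * z) \<in> ck_env_tensor_relations"
    by (induction p rule: basis_induct)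
      (auto simp: lin distrib_right pscale_mult_left intro: pscale.span_zero pscale.span_add pscale.span_scale m)
  show "env_project2 (z * p) \<in> ck_env_tensor_relations"
    by (induction p rule: basis_induct)
      (auto simp: lin distrib_left pscale_mult_right intro: pscale.span_zero pscale.span_add pscale.span_scale m)
qed

lemma free_comult_mult: "free_comult (p * q) = free_comult p * free_comult q"
proof (induction p rule: basis_induct)
  case (scale c u)
  have "free_comult (bas u * q) = free_comult (bas u) * free_comult q"
    by (induction q rule: basis_induct)
      (auto simp: free_comult_def lin_ext_add lin_ext_scale distrib_left pscale_mult_right bas_mult plus_list_def)
  then show ?case
    by (simp add: free_comult_def lin_ext_scale pscale_mult_left)
qed (auto simp: free_comult_def lin_ext_add distrib_right)

lemma env_project2_free_comult_relation:
  fixes s :: "'k::field tree_space list \<Rightarrow>\<^sub>0 'k"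
  assumes "s \<in> enveloping_relations pscale ck_bracket"
  shows "env_project2 (free_comult s) \<in> ck_env_tensor_relations"
proof -
  let ?X = "\<lambda>x :: 'k tree_space. abs_ck_env (letter x)"
  have lin: "env_project2 (free_comult (a - b)) = env_project2 (free_comult a) - env_project2 (free_comult b)"
    "env_project2 (free_comult (pscale c a)) = pscale c (env_project2 (free_comult a))"
    for a b :: "'k tree_space list \<Rightarrow>\<^sub>0 'k" and c :: 'k
    by (simp_all add: env_project2_def free_comult_def lin_ext_diff lin_ext_scale)
  have X: "env_project2 (free_comult (letter x)) = bas (?X x, 1) + bas (1, ?X x)" for x
    by (simp add: env_project2_def free_comult_def lin_ext_add abs_ck_env_bas_Nil)
  have XX: "env_project2 (free_comult (letter x * letter y)) =
      bas (?X x * ?X y, 1) + bas (?X x, ?X y) + bas (?X y, ?X x) + bas (1, ?X x * ?X y)" for x y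
    using abs_ck_env_bas_append[of "[x]" "[y]"]
    by (simp add: env_project2_def free_comult_def lin_ext_add abs_ck_env_bas_Nil bas_mult plus_list_def
        zero_list_def distrib_left distrib_right)
  consider (add) x y where "s = letter (x + y) - letter x - letter y"
    | (scale) c x where "s = letter (pscale c x) - pscale c (letter x)"
    | (bracket) x y where "s = letter x * letter y - letter y * letter x - letter (ck_bracket x y)"
    using assms by (auto simp: enveloping_relations_def)
  then show ?thesis
  proof cases
    case add
    have "env_project2 (free_comult s) =
        (bas (?X x + ?X y, 1) - bas (?X x, 1) - bas (?X y, 1)) +
        (bas (1, ?X x + ?X y) - bas (1, ?X x) - bas (1, ?X y))"
      unfolding add lin X ck_env_relations by simp
    then show ?thesis
      by (auto intro!: pscale.span_add ck_env_tensor_relations)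
  next
    case scale
    have "env_project2 (free_comult s) =
        (bas (ck_env_scale c (?X x), 1) - pscale c (bas (?X x, 1))) +
        (bas (1, ck_env_scale c (?X x)) - pscale c (bas (1, ?X x)))"
      unfolding scale lin X ck_env_relations by (simp add: pscale.scale_right_distrib)
    then show ?thesis
      by (auto intro!: pscale.span_add ck_env_tensor_relations)
  next
    case bracket
    let ?a = "?X y * ?X x" and ?b = "?X (ck_bracket x y)"
    have "env_project2 (free_comult s) =
        (bas (?a + ?b, 1) - bas (?a, 1) - bas (?b, 1)) + (bas (1, ?a + ?b) - bas (1, ?a) - bas (1, ?b))"
      unfolding bracket lin X XX ck_env_relations(3)[of x y] by simp
    then show ?thesis
      by (auto intro!: pscale.span_add ck_env_tensor_relations)
  qed
qed

lift_definition ck_env_comult :: "'k::field ck_env \<Rightarrow> ('k ck_env \<times> 'k ck_env \<Rightarrow>\<^sub>0 'k) set" is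
  "\<lambda>p. tensor_class ck_env_scale ck_env_scale (env_project2 (free_comult p))"
proof -
  fix p q :: "'k tree_space list \<Rightarrow>\<^sub>0 'k"
  have lin: "env_project2 (free_comult (a + b)) = env_project2 (free_comult a) + env_project2 (free_comult b)"
    "env_project2 (free_comult (a - b)) = env_project2 (free_comult a) - env_project2 (free_comult b)"
    for a b :: "'k tree_space list \<Rightarrow>\<^sub>0 'k"
    by (simp_all add: env_project2_def free_comult_def lin_ext_add lin_ext_diff)
  assume "ck_env_equiv p q"
  then have "p - q \<in> two_sided_ideal (enveloping_relations pscale ck_bracket)"
    by (simp add: ck_env_equiv_def enveloping_ideal_def)
  then have "env_project2 (free_comult (p - q)) \<in> ck_env_tensor_relations"
  proof induction
    case zero
    show ?case by (simp add: env_project2_def free_comult_def pscale.span_zero)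
  next
    case (add a s r t)
    then show ?case
      by (simp add: lin free_comult_mult pscale.span_add env_project2_mult env_project2_free_comult_relation)
  qed
  then show "tensor_class ck_env_scale ck_env_scale (env_project2 (free_comult p)) =
      tensor_class ck_env_scale ck_env_scale (env_project2 (free_comult q))"
    by (simp add: tensor_class_eq_iff lin)
qed

text \<open>The counit is the algebra homomorphism that vanishes on the letters: it picks the coefficient of
  the empty word.\<close>

lift_definition ck_env_counit :: "'k::field ck_env \<Rightarrow> 'k" is "\<lambda>p. Poly_Mapping.lookup p []"
proof -
  fix p q :: "'k tree_space list \<Rightarrow>\<^sub>0 'k"
  have *: "Poly_Mapping.lookup (a * b) [] = Poly_Mapping.lookup a [] * Poly_Mapping.lookup b []"
    for a b :: "'k tree_space list \<Rightarrow>\<^sub>0 'k"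
  proof (induction a rule: basis_induct)
    case (scale c u)
    have "Poly_Mapping.lookup (bas u * b) [] = Poly_Mapping.lookup (bas u) [] * Poly_Mapping.lookup b []"
      by (induction b rule: basis_induct)
        (auto simp: lookup_add distrib_left pscale_mult_right bas_mult lookup_bas plus_list_def)
    then show ?case by (simp add: pscale_mult_left)
  qed (simp_all add: lookup_add distrib_right)
  assume "ck_env_equiv p q"
  then have "p - q \<in> two_sided_ideal (enveloping_relations pscale ck_bracket)"
    by (simp add: ck_env_equiv_def enveloping_ideal_def)
  then have "Poly_Mapping.lookup (p - q) [] = 0"
    by induction (auto simp: enveloping_relations_def lookup_add lookup_minus * lookup_bas)
  then show "Poly_Mapping.lookup p [] = Poly_Mapping.lookup q []"
    by (simp add: lookup_minus)
qed

definition ck_env_hopf :: "('k::field, 'k ck_env) hopf_data" where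
  "ck_env_hopf =
     \<lparr>hscale = ck_env_scale, hmult = (*), hunit = 1, hcomult = ck_env_comult, hcounit = ck_env_counit\<rparr>"

end

theory Submission
  imports Defs
begin

text \<open>Let \<open>B t\<close> be the tree whose root has the single child \<open>t\<close>. In the Grossman-Larson algebra \<open>B s\<close>
  acts from the left by grafting \<open>s\<close> onto all vertices, so the \<open>B s\<close> span a Lie algebra whose structure
  constants count graftings. The Connes-Kreimer bracket counts cuts instead, and the two numbers differ by
  automorphisms: cuts times \<open>|Aut s| |Aut u|\<close> equals graftings times \<open>|Aut t|\<close>. Hence the Lie
  isomorphism sends \<open>Z\<^sub>t\<close> to \<open>B t / |Aut t|\<close> and needs characteristic zero; \<open>Z\<^sub>t \<mapsto> B t\<close> is not a
  homomorphism.

  For the Hopf algebras no Poincare-Birkhoff-Witt theorem is needed. Since the leading term of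
  \<open>B s \<cdot> Node M\<close> is \<open>Node (add_mset s M)\<close>, a linear map from trees to the enveloping algebra can be
  defined by recursion on the number of children of the root, splitting off an arbitrary child. The Lie
  relations show by induction that it intertwines left multiplications by primitive elements, so that the
  choice does not matter. It is bijective because the enveloping algebra acts on the Grossman-Larson
  algebra, and all other properties follow since the \<open>B s\<close> generate.\<close>

section \<open>Multisets\<close>

text \<open>Read multisets as monomials and multisets of multisets as polynomials with natural
  coefficients: \<open>replace_one g\<close> is the derivation that extends \<open>g\<close> by the
  Leibniz rule.\<close>

definition replace_one :: "('a \<Rightarrow> 'a multiset) \<Rightarrow> 'a multiset \<Rightarrow> 'a multiset multiset" where
  "replace_one g M = (\<Sum>m \<in># M. image_mset (\<lambda>m'. add_mset m' (M - {#m#})) (g m))"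

lemma replace_one_empty [simp]: "replace_one g {#} = {#}"
  by (simp add: replace_one_def)

lemma replace_one_add_mset:
  "replace_one g (add_mset m M) =
     image_mset (\<lambda>m'. add_mset m' M) (g m) + image_mset (add_mset m) (replace_one g M)"
proof -
  have "(\<Sum>x \<in># M. image_mset (\<lambda>m'. add_mset m' (add_mset m M - {#x#})) (g x)) =
      (\<Sum>x \<in># M. image_mset (\<lambda>m'. add_mset m (add_mset m' (M - {#x#}))) (g x))"
    by (intro arg_cong[where f = sum_mset] image_mset_cong) (auto simp: add_mset_commute)
  then show ?thesis
    by (simp add: replace_one_def image_mset_sum_mset image_mset.compositionality comp_def)
qed

lemma replace_one_cong: "(\<And>x. x \<in># M \<Longrightarrow> g x = h x) \<Longrightarrow> replace_one g M = replace_one h M"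
  by (auto simp: replace_one_def intro!: arg_cong[where f = sum_mset] image_mset_cong)

lemma size_replace_one: "M' \<in># replace_one g M \<Longrightarrow> size M' = size M"
  by (induction M arbitrary: M') (auto simp: replace_one_add_mset)

lemma sum_mset_add_mset_distrib: "(\<Sum>x \<in># M. add_mset (g x) (h x)) = image_mset g M + (\<Sum>x \<in># M. h x)"
  by (induction M) auto

lemma sum_mset_sum_mset: "(\<Sum>y \<in># (\<Sum>x \<in># M. g x). f y) = (\<Sum>x \<in># M. \<Sum>y \<in># g x. f y)"
  for f :: "'b \<Rightarrow> 'c::comm_monoid_add"
  by (induction M) auto

lemma sum_mset_flatten: "\<Sum>\<^sub># (\<Sum>x \<in># M. g x) = (\<Sum>x \<in># M. \<Sum>\<^sub># (g x))"
  by (induction M) auto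

lemma sum_mset_image_mset: "(\<Sum>y \<in># image_mset h M. f y) = (\<Sum>x \<in># M. f (h x))"
  by (simp add: image_mset.compositionality comp_def)

lemma sum_mset_image_mset_swap:
  "(\<Sum>x \<in># M. image_mset (\<lambda>y. f x y) N) = (\<Sum>y \<in># N. image_mset (\<lambda>x. f x y) M)"
proof (induction M)
  case (add x M)
  then show ?case by (simp add: sum_mset_add_mset_distrib)
qed simp

lemmas multiset_sum_simps = image_mset_sum_mset sum_mset_sum_mset sum_mset_flatten sum_mset_image_mset
  sum_mset.distrib sum_mset_add_mset_distrib

lemma image_mset_replace_one:
  assumes "\<And>x. x \<in># M \<Longrightarrow> g' (h x) = image_mset h (g x)"
  shows "replace_one g' (image_mset h M) = image_mset (image_mset h) (replace_one g M)"
  using assms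
  by (induction M) (simp_all add: replace_one_add_mset image_mset.compositionality comp_def)

lemma replace_one_union:
  "replace_one g (M + N) = image_mset (\<lambda>M'. M' + N) (replace_one g M) + image_mset ((+) M) (replace_one g N)"
  by (induction M) (simp_all add: replace_one_add_mset image_mset.compositionality comp_def)

lemma replace_one_plus: "replace_one (\<lambda>x. g x + h x) M = replace_one g M + replace_one h M"
  by (induction M) (simp_all add: replace_one_add_mset)

lemma replace_one_sum_mset: "replace_one (\<lambda>x. \<Sum>i \<in># I. g i x) M = (\<Sum>i \<in># I. replace_one (g i) M)"
  by (induction I) (simp_all add: replace_one_plus, simp add: replace_one_def)

text \<open>The commutator of two derivations is a derivation, hence determined by its values on
  generators: terms in which two different entries are replaced agree in both orders. The additive
  form avoids subtraction of multisets.\<close>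

lemma replace_one_commutator:
  assumes "\<And>x. x \<in># M \<Longrightarrow> (\<Sum>y \<in># g x. h y) = k x + (\<Sum>y \<in># h x. g y)"
  shows "(\<Sum>N \<in># replace_one g M. replace_one h N) = replace_one k M + (\<Sum>N \<in># replace_one h M. replace_one g N)"
  using assms
proof (induction M)
  case (add m M)
  have "image_mset (\<lambda>m'. add_mset m' M) (\<Sum>y \<in># g m. h y) =
      image_mset (\<lambda>m'. add_mset m' M) (k m + (\<Sum>y \<in># h m. g y))"
    using add.prems by simp
  moreover have "image_mset (add_mset m) (\<Sum>N \<in># replace_one g M. replace_one h N) =
      image_mset (add_mset m) (replace_one k M + (\<Sum>N \<in># replace_one h M. replace_one g N))"
    using add by simp
  ultimately show ?case
    using sum_mset_image_mset_swap[of "\<lambda>m' N. add_mset m' N" "replace_one h M" "g m"]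
    by (simp add: replace_one_add_mset multiset_sum_simps
        sum_mset_image_mset_swap[of add_mset])
qed simp

section \<open>Grafting\<close>

definition graft :: "rtree \<Rightarrow> rtree \<Rightarrow> rtree multiset" where
  "graft s t = image_mset attach_decorations (place s (undecorated t))"

text \<open>A vertex of \<open>attach_decorations d\<close> is either a vertex of \<open>d\<close>, where \<open>place\<close> grafts, or a vertex of
  one of the decorations, where \<open>regraft\<close> does.\<close>

primrec regraft :: "rtree \<Rightarrow> dtree \<Rightarrow> dtree multiset" where
  "regraft s (DNode D F) =
     image_mset (\<lambda>D'. DNode D' F) (replace_one (graft s) D) +
     (\<Sum>(f, P) \<in># image_mset (\<lambda>f. (f, regraft s f)) F. image_mset (\<lambda>f'. DNode D (add_mset f' (F - {#f#}))) P)"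

text \<open>On the forest below the root, \<open>place s\<close> acts as a derivation; in this form
  the laws of \<open>replace_one\<close> apply to it.\<close>

lemma place_eq:
  "place s (DNode D F) = add_mset (DNode (add_mset s D) F) (image_mset (DNode D) (replace_one (place s) F))"
  by (simp add: place_DNode replace_one_def image_mset_sum_mset image_mset.compositionality comp_def del: place.simps)

lemma regraft_eq:
  "regraft s (DNode D F) =
     image_mset (\<lambda>D'. DNode D' F) (replace_one (graft s) D) + image_mset (DNode D) (replace_one (regraft s) F)"
  by (simp add: replace_one_def image_mset_sum_mset image_mset.compositionality comp_def)

declare place.simps [simp del] regraft.simps [simp del]

lemma attach_undecorated [simp]: "attach_decorations (undecorated t) = t"
  by (induction t) (simp add: image_mset.compositionality comp_def cong: image_mset_cong)

lemma regraft_undecorated [simp]: "regraft s (undecorated t) = {#}"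
proof (induction t)
  case (Node M)
  have "replace_one (regraft s) (image_mset undecorated M) = replace_one (\<lambda>_. {#}) (image_mset undecorated M)"
    using Node by (intro replace_one_cong) auto
  then show ?case
    by (simp add: regraft_eq) (simp add: replace_one_def)
qed

text \<open>The vertices of \<open>Node M\<close> are its root and the vertices of its subtrees.
  This gives a recursion for grafting that no longer mentions decorations.\<close>

lemma graft_Node:
  "graft s (Node M) = add_mset (Node (add_mset s M)) (image_mset Node (replace_one (graft s) M))"
proof -
  have "replace_one (graft s) (image_mset attach_decorations (image_mset undecorated M)) =
      image_mset (image_mset attach_decorations) (replace_one (place s) (image_mset undecorated M))"
    by (rule image_mset_replace_one) (auto simp: graft_def)
  then show ?thesis
    by (subst graft_def) (simp add: place_eq image_mset.compositionality comp_def)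
qed

lemma graft_attach:
  "graft s (attach_decorations d) = image_mset attach_decorations (place s d + regraft s d)"
proof (induction d)
  case (DNode D F)
  have "replace_one (graft s) (image_mset attach_decorations F) =
      image_mset (image_mset attach_decorations) (replace_one (\<lambda>f. place s f + regraft s f) F)"
    by (rule image_mset_replace_one) (rule DNode)
  then show ?case
    by (simp add: graft_Node place_eq regraft_eq replace_one_union replace_one_plus image_mset.compositionality comp_def)
qed

text \<open>A vertex in a decoration of \<open>place m d\<close> lies in the new copy of
  \<open>m\<close>, where grafting amounts to placing a member of \<open>graft s m\<close> instead,
  or in an old decoration, where the two operations do not interfere.\<close>

lemma regraft_place:
  "(\<Sum>d' \<in># place m d. regraft s d') = (\<Sum>m' \<in># graft s m. place m' d) + (\<Sum>d' \<in># regraft s d. place m d')"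
proof (induction d)
  case (DNode D F)
  have "(\<Sum>F' \<in># replace_one (place m) F. replace_one (regraft s) F') =
      replace_one (\<lambda>f. \<Sum>m' \<in># graft s m. place m' f) F + (\<Sum>F' \<in># replace_one (regraft s) F. replace_one (place m) F')"
    by (rule replace_one_commutator) (rule DNode)
  from arg_cong[OF this, of "image_mset (DNode D)"] show ?case
    using sum_mset_image_mset_swap[of "\<lambda>F' D'. DNode D' F'" "replace_one (graft s) D" "replace_one (place m) F"]
    by (simp add: place_eq regraft_eq replace_one_add_mset multiset_sum_simps replace_one_sum_mset
        image_mset.compositionality comp_def sum_mset_image_mset_swap[of "\<lambda>F' D'. DNode D' F'"] add_ac)
qed

lemma regraft_placements:
  "(\<Sum>d \<in># placements M t. regraft s d) = (\<Sum>N \<in># replace_one (graft s) M. placements N t)"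
proof (induction M)
  case empty
  then show ?case by (simp add: placements_empty)
next
  case (add m M)
  have "(\<Sum>d \<in># placements (add_mset m M) t. regraft s d) =
      (\<Sum>m' \<in># graft s m. placements (add_mset m' M) t) + (\<Sum>d \<in># (\<Sum>d \<in># placements M t. regraft s d). place m d)"
    by (simp add: placements_add_mset multiset_sum_simps regraft_place sum_mset.swap[of _ _ "placements M t"])
  then show ?case
    by (simp add: add replace_one_add_mset placements_add_mset multiset_sum_simps)
qed

lemma gl_products_single: "gl_products (Node {#s#}) t = graft s t"
  by (simp add: gl_products_def placements_add_mset placements_empty graft_def)

text \<open>Associativity of the product \<open>B s\<close>, \<open>u\<close>, \<open>t\<close>. A
  vertex of a product tree belongs to \<open>t\<close>, and grafting there amounts to grafting
  \<open>s\<close> onto the root of \<open>u\<close> beforehand, or to an attached subtree, and then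
  it stems from another vertex of \<open>u\<close>.\<close>

lemma graft_gl_products:
  "(\<Sum>r \<in># gl_products u t. graft s r) = (\<Sum>r \<in># graft s u. gl_products r t)"
proof (cases u)
  case (Node M)
  have "(\<Sum>r \<in># gl_products u t. graft s r) =
      image_mset attach_decorations ((\<Sum>d \<in># placements M t. place s d) + (\<Sum>d \<in># placements M t. regraft s d))"
    by (simp add: Node gl_products_def multiset_sum_simps graft_attach)
  then show ?thesis
    by (simp add: regraft_placements Node gl_products_def graft_Node placements_add_mset multiset_sum_simps)
qed

section \<open>Cuts and automorphisms\<close>

text \<open>The order of the automorphism group: permutations of isomorphic child subtrees, times
  the automorphisms of each of them.\<close>

primrec symmetries :: "rtree \<Rightarrow> nat" where
  "symmetries (Node M) = (\<Prod>s \<in> set_mset M. fact (count M s)) * \<Prod>\<^sub># (image_mset symmetries M)"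

lemma prod_fact_count_add_mset:
  "(\<Prod>x \<in> set_mset (add_mset s M). fact (count (add_mset s M) x)) =
     Suc (count M s) * (\<Prod>x \<in> set_mset M. fact (count M x))"
proof -
  have eq: "(\<Prod>x \<in> set_mset N. fact (count N x)) = fact (count N s) * (\<Prod>x \<in> set_mset N - {s}. fact (count N x) :: nat)"
    for N :: "'a multiset"
    by (cases "s \<in># N") (simp_all add: prod.remove not_in_iff)
  have "(\<Prod>x \<in> set_mset (add_mset s M) - {s}. fact (count (add_mset s M) x)) =
      (\<Prod>x \<in> set_mset M - {s}. fact (count M x) :: nat)"
    by (rule prod.cong) auto
  then show ?thesis unfolding eq[of M] eq[of "add_mset s M"] by (simp only: count_add_mset if_True simp_thms fact_Suc mult.assoc of_nat_id)
qed

lemma symmetries_add_mset: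
  "symmetries (Node (add_mset s M)) = Suc (count M s) * symmetries s * symmetries (Node M)"
  unfolding symmetries.simps prod_fact_count_add_mset by (simp add: algebra_simps)

lemma symmetries_pos [simp]: "symmetries t > 0"
proof (induction t)
  case (Node M)
  then show ?case by (auto intro!: prod_pos simp: prod_mset_zero_iff neq0_conv[symmetric] simp del: neq0_conv)
qed

text \<open>The constant inner sum expresses a multiple in any commutative monoid, so the lemma
  serves for natural numbers and for vectors.\<close>

lemma sum_mset_eq_sum_set_mset: "(\<Sum>x \<in># M. g x) = (\<Sum>x \<in> set_mset M. \<Sum>_ < count M x. g x)"
  for g :: "'a \<Rightarrow> 'b::comm_monoid_add"
proof (induction M)
  case (add m M)
  have eq: "(\<Sum>x \<in> set_mset N. \<Sum>_ < count N x. g x) =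
      (\<Sum>_ < count N m. g m) + (\<Sum>x \<in> set_mset N - {m}. \<Sum>_ < count N x. g x)" for N
    by (cases "m \<in># N") (simp_all add: sum.remove not_in_iff)
  have "(\<Sum>x \<in> set_mset (add_mset m M) - {m}. \<Sum>_ < count (add_mset m M) x. g x) =
      (\<Sum>x \<in> set_mset M - {m}. \<Sum>_ < count M x. g x)"
    by (rule sum.cong) auto
  then show ?case using add unfolding eq[of M] eq[of "add_mset m M"] by (simp add: add_ac)
qed simp

lemma count_sum_mset_image: "count (\<Sum>x \<in># M. g x) y = (\<Sum>x \<in> set_mset M. count M x * count (g x) y)"
proof -
  have "count (\<Sum>x \<in># M. g x) y = (\<Sum>x \<in># M. count (g x) y)"
    by (induction M) auto
  then show ?thesis by (simp add: sum_mset_eq_sum_set_mset)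
qed

lemma count_image_mset_inj: "inj f \<Longrightarrow> count (image_mset f A) (f x) = count A x"
  by (induction A) (auto simp: inj_eq)

lemma add_mset_right_cancel: "add_mset x K = add_mset y K \<longleftrightarrow> x = y"
  by (metis add_mset_add_single add_left_cancel single_eq_single)

text \<open>At most one summand is nonzero, since \<open>M\<close> and \<open>K\<close> determine
  the added entry. The shape of a sum gives cuts and graftings a common index set later.\<close>

lemma count_image_add_mset:
  "count (image_mset (\<lambda>x. add_mset x K) A) M = (\<Sum>x \<in> set_mset M. if M - {#x#} = K then count A x else 0)"
proof (cases "\<exists>y. M = add_mset y K")
  case True
  then obtain y where M: "M = add_mset y K" by blast
  have "(\<Sum>x \<in> set_mset M. if M - {#x#} = K then count A x else 0) = (\<Sum>x \<in> {y}. count A x)"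
  proof (rule sum.mono_neutral_cong_right)
    show "\<forall>x \<in> set_mset M - {y}. (if M - {#x#} = K then count A x else 0) = 0"
    proof
      fix x assume x: "x \<in> set_mset M - {y}"
      then have "M = add_mset x (M - {#x#})" by simp
      then have "M - {#x#} \<noteq> K" using x M by (metis DiffD2 add_mset_right_cancel singletonI)
      then show "(if M - {#x#} = K then count A x else 0) = 0" by simp
    qed
  qed (simp_all add: M)
  moreover have "count (image_mset (\<lambda>x. add_mset x K) A) (add_mset y K) = count A y"
    by (rule count_image_mset_inj) (simp add: inj_def add_mset_right_cancel)
  ultimately show ?thesis by (simp add: M)
next
  case False
  then have "count (image_mset (\<lambda>x. add_mset x K) A) M = 0"
    by (auto simp: count_eq_zero_iff)
  moreover have "M - {#x#} \<noteq> K" if "x \<in># M" for x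
    using False that by (metis insert_DiffM)
  ultimately show ?thesis by simp
qed

lemma count_add_mset_if: "count (add_mset x M) y = (if x = y then 1 else 0) + count M y"
  by simp

text \<open>The first term counts edges at the root. Any other cut lies inside a child
  \<open>s\<close> and turns it into a child \<open>v\<close> of the trunk, while the remaining
  children stay the same.\<close>

lemma count_cuts:
  "count (cuts (Node M)) (b, Node U) =
     (if M = add_mset b U then count M b else 0) +
     (\<Sum>s \<in> set_mset M. \<Sum>v \<in> set_mset U. if M - {#s#} = U - {#v#} then count M s * count (cuts s) (b, v) else 0)"
proof -
  \<comment> \<open>Only pairs with first entry \<open>b\<close> contribute, so what is counted are
    trunks.\<close>
  have "count (image_mset (\<lambda>(b, v). (b, Node (add_mset v K))) C) (b, Node U) =
      count (image_mset (\<lambda>v. add_mset v K) (image_mset snd (filter_mset (\<lambda>p. fst p = b) C))) U" for C K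
  proof (induction C)
    case (add p C)
    then show ?case by (cases p) simp
  qed simp
  moreover have "count (image_mset snd (filter_mset (\<lambda>p. fst p = b) C)) v = count C (b, v)"
    for C :: "(rtree \<times> rtree) multiset" and v
  proof (induction C)
    case (add p C)
    then show ?case by (cases p) simp
  qed simp
  ultimately have inner: "count (image_mset (\<lambda>(b, v). (b, Node (add_mset v (M - {#s#})))) (cuts s)) (b, Node U) =
      (\<Sum>v \<in> set_mset U. if M - {#s#} = U - {#v#} then count (cuts s) (b, v) else 0)" for s
    by (simp only: count_image_add_mset) (rule sum.cong, auto)
  have "(\<Sum>s \<in> set_mset M. count M s * (if (s, Node (M - {#s#})) = (b, Node U) then 1 else 0)) =
      (\<Sum>s \<in> set_mset M. if s = b then if M = add_mset b U then count M b else 0 else 0)"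
  proof (rule sum.cong)
    fix s assume "s \<in># M"
    then have "M - {#s#} = U \<longleftrightarrow> M = add_mset s U" by auto
    then show "count M s * (if (s, Node (M - {#s#})) = (b, Node U) then 1 else 0) =
        (if s = b then if M = add_mset b U then count M b else 0 else 0)" by auto
  qed simp
  also have "\<dots> = (if M = add_mset b U then count M b else 0)"
    by (simp add: sum.delta)
  finally show ?thesis
    unfolding cuts_Node count_sum_mset_image count_add_mset_if inner
    by (simp add: sum.distrib distrib_left sum_distrib_left if_distrib[of "(*) _"] cong: if_cong)
qed

lemma count_graft:
  "count (graft b (Node U)) (Node M) =
     (if M = add_mset b U then 1 else 0) +
     (\<Sum>v \<in> set_mset U. \<Sum>s \<in> set_mset M. if M - {#s#} = U - {#v#} then count U v * count (graft b v) s else 0)"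
proof -
  have "count (image_mset Node (replace_one (graft b) U)) (Node M) = count (replace_one (graft b) U) M"
    by (rule count_image_mset_inj) (simp add: inj_def add_mset_right_cancel)
  then show ?thesis
    by (simp add: graft_Node replace_one_def count_sum_mset_image count_image_add_mset sum_distrib_left
        if_distrib[of "(*) _"] cong: if_cong)
qed

text \<open>The recursions \<open>count_cuts\<close> and \<open>count_graft\<close> run over the
  same pairs \<open>(s, v)\<close> and are compared term by term. For a cut at the root, the factor
  \<open>count M b\<close> is the one that \<open>symmetries_add_mset\<close> provides.\<close>

lemma cuts_graft_symmetries:
  "count (cuts t) (b, u) * symmetries b * symmetries u = count (graft b u) t * symmetries t"
proof (induction t arbitrary: u)
  case (Node M)
  obtain U where u: "u = Node U" by (cases u)
  have "(if M - {#s#} = U - {#v#} then count M s * count (cuts s) (b, v) else 0) * symmetries b * symmetries (Node U) =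
      (if M - {#s#} = U - {#v#} then count U v * count (graft b v) s else 0) * symmetries (Node M)"
    if "s \<in># M" "v \<in># U" for s v
  proof (cases "M - {#s#} = U - {#v#}")
    case True
    \<comment> \<open>The children common to both trees. Adding \<open>s\<close> or \<open>v\<close>
      to \<open>W\<close> gives \<open>M\<close> or \<open>U\<close> and changes the automorphism
      number by a known factor; the induction hypothesis then compares \<open>s\<close> with
      \<open>v\<close>.\<close>
    define W where "W = U - {#v#}"
    have W: "M = add_mset s W" "U = add_mset v W"
      using that True by (metis W_def insert_DiffM)+
    have "(count M s * count (cuts s) (b, v)) * symmetries b * symmetries (Node U) =
        (Suc (count W s) * Suc (count W v) * symmetries (Node W)) * (count (cuts s) (b, v) * symmetries b * symmetries v)"
      using W by (simp only: symmetries_add_mset count_add_mset if_True simp_thms mult_ac)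
    also have "\<dots> = (Suc (count W s) * Suc (count W v) * symmetries (Node W)) * (count (graft b v) s * symmetries s)"
      by (simp only: Node[OF that(1)])
    also have "\<dots> = (count U v * count (graft b v) s) * symmetries (Node M)"
      using W by (simp only: symmetries_add_mset count_add_mset if_True simp_thms mult_ac)
    finally show ?thesis using True by simp
  qed simp
  then have "(\<Sum>s \<in> set_mset M. \<Sum>v \<in> set_mset U. if M - {#s#} = U - {#v#} then count M s * count (cuts s) (b, v) else 0)
        * symmetries b * symmetries (Node U) =
      (\<Sum>s \<in> set_mset M. \<Sum>v \<in> set_mset U. if M - {#s#} = U - {#v#} then count U v * count (graft b v) s else 0)
        * symmetries (Node M)"
    unfolding sum_distrib_right by (intro sum.cong refl) blast
  moreover have "(if M = add_mset b U then count M b else 0) * symmetries b * symmetries (Node U) =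
      (if M = add_mset b U then 1 else 0) * symmetries (Node M)"
    by (simp add: symmetries_add_mset del: symmetries.simps)
  ultimately show ?case
    unfolding u count_cuts count_graft distrib_right
    by (simp only: sum.swap[of _ "set_mset U" "set_mset M"])
qed

section \<open>The Lie algebra of planted trees\<close>

lemma lin_ext_sum: "lin_ext f (\<Sum>x \<in> A. g x) = (\<Sum>x \<in> A. lin_ext f (g x))"
  for f :: "_ \<Rightarrow> (_ \<Rightarrow>\<^sub>0 'k::field)"
  by (induction A rule: infinite_finite_induct) (auto simp: lin_ext_add)

lemma lin_ext_sum_mset: "lin_ext f (\<Sum>x \<in># M. g x) = (\<Sum>x \<in># M. lin_ext f (g x))"
  for f :: "_ \<Rightarrow> (_ \<Rightarrow>\<^sub>0 'k::field)"
  by (induction M) (auto simp: lin_ext_add)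

lemma sum_mset_eq_sum_pscale:
  "(\<Sum>x \<in># M. g x) = (\<Sum>x \<in> set_mset M. pscale (of_nat (count M x)) (g x))"
  for g :: "'a \<Rightarrow> ('b \<Rightarrow>\<^sub>0 'k::field)"
proof -
  have "(\<Sum>_ < n. v) = pscale (of_nat n) v" for n and v :: "'b \<Rightarrow>\<^sub>0 'k"
    by (induction n) (auto simp: pscale.scale_left_distrib add_ac)
  then show ?thesis by (simp add: sum_mset_eq_sum_set_mset)
qed

lemma bilin_ext_add_left: "bilin_ext f (p + p') q = bilin_ext f p q + bilin_ext f p' q"
  and bilin_ext_scale_left: "bilin_ext f (pscale c p) q = pscale c (bilin_ext f p q)"
  and bilin_ext_diff_left: "bilin_ext f (p - p') q = bilin_ext f p q - bilin_ext f p' q"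
  and bilin_ext_0_left: "bilin_ext f 0 q = 0"
  for f :: "_ \<Rightarrow> _ \<Rightarrow> (_ \<Rightarrow>\<^sub>0 'k::field)"
  by (simp_all add: bilin_ext_def lin_ext_add lin_ext_scale lin_ext_diff)

lemma bilin_ext_add_right: "bilin_ext f p (q + q') = bilin_ext f p q + bilin_ext f p q'"
  and bilin_ext_scale_right: "bilin_ext f p (pscale c q) = pscale c (bilin_ext f p q)"
  and bilin_ext_0_right: "bilin_ext f p 0 = 0"
  for f :: "_ \<Rightarrow> _ \<Rightarrow> (_ \<Rightarrow>\<^sub>0 'k::field)"
  by (induction p rule: basis_induct;
      auto simp: bilin_ext_def lin_ext_add lin_ext_scale pscale.scale_right_distrib add_ac)+

lemma bilin_ext_diff_right: "bilin_ext f p (q - q') = bilin_ext f p q - bilin_ext f p q'"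
  for f :: "_ \<Rightarrow> _ \<Rightarrow> (_ \<Rightarrow>\<^sub>0 'k::field)"
  using bilin_ext_add_right[of f p "q - q'" q'] by (simp add: algebra_simps)

lemma bilin_ext_sum_mset_left: "bilin_ext f (\<Sum>x \<in># M. g x) q = (\<Sum>x \<in># M. bilin_ext f (g x) q)"
  and bilin_ext_sum_mset_right: "bilin_ext f p (\<Sum>x \<in># M. g' x) = (\<Sum>x \<in># M. bilin_ext f p (g' x))"
  for f :: "_ \<Rightarrow> _ \<Rightarrow> (_ \<Rightarrow>\<^sub>0 'k::field)"
  by (induction M) (simp_all add: bilin_ext_0_left bilin_ext_0_right bilin_ext_add_left bilin_ext_add_right)

lemma bilin_ext_bas: "bilin_ext f (bas x) (bas y) = f x y"
  for f :: "_ \<Rightarrow> _ \<Rightarrow> (_ \<Rightarrow>\<^sub>0 'k::field)"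
  by (simp add: bilin_ext_def)

lemmas bilin_ext_simps = bilin_ext_add_left bilin_ext_scale_left bilin_ext_diff_left bilin_ext_0_left
  bilin_ext_add_right bilin_ext_scale_right bilin_ext_diff_right bilin_ext_0_right
  bilin_ext_sum_mset_left bilin_ext_sum_mset_right
lemmas gl_mult_simps = bilin_ext_simps[of "\<lambda>t1 t2. \<Sum>t \<in># gl_products t1 t2. bas t", folded gl_mult_def]
lemmas ck_star_simps = bilin_ext_simps[of "\<lambda>t1 t2. \<Sum>t | cut_number t1 t2 t \<noteq> 0.
  pscale (of_nat (cut_number t1 t2 t)) (bas t)", folded ck_star_def]

lemma gl_mult_bas: "gl_mult (bas u) (bas t) = (\<Sum>r \<in># gl_products u t. bas r :: 'k::field tree_space)"
  by (simp add: gl_mult_def bilin_ext_bas)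

lemma gl_mult_bas_graft: "gl_mult (bas (Node {#s#})) (bas t) = (\<Sum>r \<in># graft s t. bas r :: 'k::field tree_space)"
  by (simp add: gl_mult_bas gl_products_single)

lemma gl_mult_unit: "gl_mult (bas \<e>) a = (a :: 'k::field tree_space)"
  by (induction a rule: basis_induct) (auto simp: gl_mult_simps gl_mult_bas gl_products_def placements_empty)

section \<open>The normalised planting map and its compatibility with the brackets\<close>

definition plant :: "'k::field_char_0 tree_space \<Rightarrow> 'k tree_space" where
  "plant = lin_ext (\<lambda>t. pscale (inverse (of_nat (symmetries t))) (bas (Node {#t#})))"

lemma plant_simps:
  "plant (x + y) = plant x + plant y" "plant (x - y) = plant x - plant y" "plant (pscale c x) = pscale c (plant x)"
  "plant 0 = 0"
  by (simp_all add: plant_def lin_ext_add lin_ext_scale lin_ext_diff)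

lemma plant_bas: "plant (bas t) = pscale (inverse (of_nat (symmetries t))) (bas (Node {#t#}))"
  by (simp add: plant_def)

lemma symmetries_neq_0: "of_nat (symmetries t) \<noteq> (0 :: 'k::field_char_0)"
  using symmetries_pos[of t] by simp

lemma plant_scaled_bas: "plant (pscale (of_nat (symmetries t)) (bas t)) = bas (Node {#t#})"
  by (simp add: plant_simps plant_bas symmetries_neq_0)

lemma gl_mult_plant_assoc: "gl_mult (plant x) (gl_mult a b) = gl_mult (gl_mult (plant x) a) b"
  for a b :: "'k::field_char_0 tree_space"
proof -
  have 1: "gl_mult (bas (Node {#s#})) (gl_mult (bas u) (bas t)) =
      (gl_mult (gl_mult (bas (Node {#s#})) (bas u)) (bas t) :: 'k tree_space)" for s u t
    using arg_cong[OF graft_gl_products[of s u t], of "\<lambda>N. \<Sum>r \<in># N. bas r :: 'k tree_space"]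
    by (simp add: gl_mult_bas gl_products_single gl_mult_simps sum_mset_sum_mset)
  have 2: "gl_mult (bas (Node {#s#})) (gl_mult (bas u) b) =
      gl_mult (gl_mult (bas (Node {#s#})) (bas u)) b" for s u
    by (induction b rule: basis_induct) (simp_all add: gl_mult_simps 1)
  have 3: "gl_mult (bas (Node {#s#})) (gl_mult a b) = gl_mult (gl_mult (bas (Node {#s#})) a) b" for s
    by (induction a rule: basis_induct) (simp_all add: gl_mult_simps 2)
  show ?thesis
    by (induction x rule: basis_induct) (simp_all add: gl_mult_simps plant_simps plant_bas 3)
qed

text \<open>Dividing \<open>cuts_graft_symmetries\<close> by the automorphism numbers turns cut
  coefficients into grafting multiplicities.\<close>

lemma plant_ck_star_bas:
  "plant (ck_star (bas t1) (bas t2)) =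
     (pscale (inverse (of_nat (symmetries t1 * symmetries t2))) (\<Sum>t \<in># graft t1 t2. bas (Node {#t#})) :: 'k::field_char_0 tree_space)"
proof -
  have adj: "cut_number t1 t2 t * symmetries t1 * symmetries t2 = count (graft t1 t2) t * symmetries t" for t
    unfolding cut_number_def by (rule cuts_graft_symmetries)
  have "cut_number t1 t2 t = 0 \<longleftrightarrow> t \<notin># graft t1 t2" for t
    using adj[of t] symmetries_pos by (metis mult_eq_0_iff not_in_iff not_gr_zero)
  then have set: "{t. 0 < cut_number t1 t2 t} = set_mset (graft t1 t2)"
    by (auto simp: neq0_conv[symmetric] simp del: neq0_conv)
  have coeff: "of_nat (cut_number t1 t2 t) * inverse (of_nat (symmetries t)) =
      (inverse (of_nat (symmetries t1 * symmetries t2)) * of_nat (count (graft t1 t2) t) :: 'k)" for t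
    using arg_cong[OF adj[of t], of "of_nat :: nat \<Rightarrow> 'k"] symmetries_neq_0[where 'k = 'k]
    by (simp add: field_simps)
  show ?thesis
    by (simp add: ck_star_def bilin_ext_bas plant_def lin_ext_sum lin_ext_scale set sum_mset_eq_sum_pscale
        pscale.scale_sum_right coeff del: of_nat_mult)
qed

lemma plant_bracket:
  "plant (ck_bracket x y) = gl_mult (plant x) (plant y) - gl_mult (plant y) (plant x)"
  for x y :: "'k::field_char_0 tree_space"
proof -
  have comm: "plant (ck_bracket (bas t1) (bas t2)) =
      (gl_mult (plant (bas t1)) (plant (bas t2)) - gl_mult (plant (bas t2)) (plant (bas t1)) :: 'k tree_space)" for t1 t2
  proof -
    \<comment> \<open>The tree with children \<open>s\<close> and \<open>t\<close> is symmetric in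
      them and cancels in the commutator; only planted graftings survive.\<close>
    have "graft s (Node {#t#}) = add_mset (Node {#s, t#}) (image_mset (\<lambda>r. Node {#r#}) (graft s t))" for s t
      by (simp add: graft_Node replace_one_add_mset image_mset.compositionality comp_def)
    then show ?thesis
      by (simp add: ck_bracket_def plant_simps plant_ck_star_bas plant_bas gl_mult_simps gl_mult_bas_graft
          image_mset.compositionality comp_def pscale.scale_right_distrib add_mset_commute mult.commute)
  qed
  have 1: "plant (ck_bracket (bas t1) y) =
      gl_mult (plant (bas t1)) (plant y) - gl_mult (plant y) (plant (bas t1))" for t1
  proof (induction y rule: basis_induct)
    case (scale c t)
    then show ?case using comm[of t1 t]
      by (simp add: ck_bracket_def plant_simps ck_star_simps gl_mult_simps flip: pscale.scale_right_diff_distrib)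
  qed (simp_all add: ck_bracket_def plant_simps ck_star_simps gl_mult_simps add_diff_add)
  show ?thesis
  proof (induction x rule: basis_induct)
    case (scale c t)
    then show ?case using 1[of t]
      by (simp add: ck_bracket_def plant_simps ck_star_simps gl_mult_simps flip: pscale.scale_right_diff_distrib)
  qed (simp_all add: ck_bracket_def plant_simps ck_star_simps gl_mult_simps add_diff_add)
qed

section \<open>Primitive elements\<close>

lemma bilinearity_span:
  "bas (v + v', w) - bas (v, w) - bas (v', w) \<in> pscale.span (bilinearity_relations s1 s2)"
  "bas (v, w + w') - bas (v, w) - bas (v, w') \<in> pscale.span (bilinearity_relations s1 s2)"
  "bas (s1 c v, w) - pscale c (bas (v, w)) \<in> pscale.span (bilinearity_relations s1 s2)"
  "bas (v, s2 c w) - pscale c (bas (v, w)) \<in> pscale.span (bilinearity_relations s1 s2)"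
  by (rule pscale.span_base; force simp: bilinearity_relations_def)+

text \<open>Coordinates in the basis of pairs of basis vectors, computed on representatives. The
  bilinearity relations turn out to span exactly the kernel.\<close>

definition tensor_coeffs :: "(('a \<Rightarrow>\<^sub>0 'k::field) \<times> ('b \<Rightarrow>\<^sub>0 'k) \<Rightarrow>\<^sub>0 'k) \<Rightarrow> ('a \<times> 'b \<Rightarrow>\<^sub>0 'k)" where
  "tensor_coeffs = lin_ext (\<lambda>(v, w). bilin_ext (\<lambda>x y. bas (x, y)) v w)"

lemma tensor_coeffs_simps:
  "tensor_coeffs (x + y) = tensor_coeffs x + tensor_coeffs y"
  "tensor_coeffs (x - y) = tensor_coeffs x - tensor_coeffs y"
  "tensor_coeffs (pscale c x) = pscale c (tensor_coeffs x)"
  "tensor_coeffs 0 = 0"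
  "tensor_coeffs (\<Sum>i \<in># I. f i) = (\<Sum>i \<in># I. tensor_coeffs (f i))"
  by (simp_all add: tensor_coeffs_def lin_ext_add lin_ext_scale lin_ext_diff lin_ext_sum_mset)

lemma tensor_coeffs_bas: "tensor_coeffs (bas (v, w)) = bilin_ext (\<lambda>x y. bas (x, y)) v w"
  by (simp add: tensor_coeffs_def)

lemma tensor_coeffs_span:
  assumes "z \<in> pscale.span (bilinearity_relations pscale pscale)"
  shows "tensor_coeffs z = 0"
  using assms
proof (induction rule: pscale.span_induct_alt)
  case (step c r z)
  then have "tensor_coeffs r = 0"
    by (elim bilinearity_relations_cases) (simp_all add: tensor_coeffs_simps tensor_coeffs_bas bilin_ext_simps)
  with step show ?case by (simp add: tensor_coeffs_simps)
qed (simp add: tensor_coeffs_simps)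

text \<open>Modulo the relations a pair of vectors expands bilinearly: first the second entry next
  to a basis vector, then the first entry.\<close>

lemma tensor_coeffs_canonical:
  fixes z :: "('a \<Rightarrow>\<^sub>0 'k::field) \<times> ('b \<Rightarrow>\<^sub>0 'k) \<Rightarrow>\<^sub>0 'k"
  shows "z - lin_ext (\<lambda>(x, y). bas (bas x, bas y)) (tensor_coeffs z) \<in> pscale.span (bilinearity_relations pscale pscale)"
    (is "z - ?C (tensor_coeffs z) \<in> ?S")
proof -
  have comb: "p - (q + r) \<in> ?S" if "p - p1 - p2 \<in> ?S" "p1 - q \<in> ?S" "p2 - r \<in> ?S" for p p1 p2 q r
    using pscale.span_add[OF that(1) pscale.span_add[OF that(2,3)]] by (simp add: algebra_simps)
  have scal: "p - pscale c q \<in> ?S" if "p - pscale c p1 \<in> ?S" "p1 - q \<in> ?S" for p p1 q c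
    using pscale.span_add[OF that(1) pscale.span_scale[OF that(2), of c]]
    by (simp add: pscale.scale_right_diff_distrib)
  \<comment> \<open>A pair with a zero entry is a nonzero vector of the free space; scaling by
    \<open>0\<close> shows that it lies in the span of the relations.\<close>
  have zero: "bas (0, w) \<in> ?S" "bas (v, 0) \<in> ?S" for v w
    using bilinearity_span(3)[of pscale 0 v w pscale] bilinearity_span(4)[of v pscale 0 w pscale] by simp_all
  have 1: "bas (bas x, w) - ?C (tensor_coeffs (bas (bas x, w))) \<in> ?S" for x w
  proof (induction w rule: basis_induct)
    case (add p q)
    show ?case
      using comb[OF bilinearity_span(2) add] by (simp add: tensor_coeffs_bas bilin_ext_simps lin_ext_add)
  next
    case (scale c y)
    show ?case
      using scal[OF bilinearity_span(4)[of "bas x" pscale c "bas y"], of "bas (bas x, bas y)"]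
      by (simp add: tensor_coeffs_bas bilin_ext_simps lin_ext_scale bilin_ext_bas pscale.span_zero)
  qed (simp add: tensor_coeffs_bas bilin_ext_simps zero)
  have 2: "bas (v, w) - ?C (tensor_coeffs (bas (v, w))) \<in> ?S" for v w
  proof (induction v rule: basis_induct)
    case (add p q)
    show ?case
      using comb[OF bilinearity_span(1) add] by (simp add: tensor_coeffs_bas bilin_ext_simps lin_ext_add)
  next
    case (scale c x)
    show ?case
      using scal[OF bilinearity_span(3) 1[of x w], of c]
      by (simp add: tensor_coeffs_bas bilin_ext_simps lin_ext_scale)
  qed (simp add: tensor_coeffs_bas bilin_ext_simps zero)
  show ?thesis
  proof (induction z rule: basis_induct)
    case (add p q)
    then show ?case using pscale.span_add[OF add] by (simp add: tensor_coeffs_simps lin_ext_add add_diff_add)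
  next
    case (scale c vw)
    then show ?case using pscale.span_scale[OF 2[of "fst vw" "snd vw"], of c]
      by (simp add: tensor_coeffs_simps lin_ext_scale pscale.scale_right_diff_distrib)
  qed (simp add: tensor_coeffs_simps pscale.span_zero)
qed

lemma tensor_coeffs_eq_0_iff:
  "tensor_coeffs z = 0 \<longleftrightarrow> z \<in> pscale.span (bilinearity_relations pscale pscale)"
  using tensor_coeffs_canonical[of z] tensor_coeffs_span[of z] by auto

lemma tensor_class_eq_iff_coeffs:
  "tensor_class pscale pscale p = tensor_class pscale pscale q \<longleftrightarrow> tensor_coeffs p = tensor_coeffs q"
  by (simp add: tensor_class_eq_iff tensor_coeffs_simps flip: tensor_coeffs_eq_0_iff)

section \<open>Ordered splits and the coproduct\<close>

lemma ordered_splits_union: "(l, r) \<in># ordered_splits M \<Longrightarrow> l + r = M"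
  by (induction M arbitrary: l r) (auto simp: ordered_splits_empty ordered_splits_add_mset)

lemma ordered_splits_single: "ordered_splits {#s#} = {#({#s#}, {#}), ({#}, {#s#})#}"
  by (simp add: ordered_splits_add_mset ordered_splits_empty)

lemma ordered_splits_mem: "(l, r) \<in># ordered_splits (l + r)"
proof (induction l)
  case empty
  show ?case by (induction r) (force simp: ordered_splits_empty ordered_splits_add_mset)+
qed (force simp: ordered_splits_add_mset)

text \<open>\<open>ordered_splits\<close> is the coproduct of the polynomial algebra with primitive
  generators. A derivation that sends generators to sums of generators is also a
  coderivation.\<close>

lemma ordered_splits_replace_one:
  "(\<Sum>N \<in># replace_one g M. ordered_splits N) =
     (\<Sum>(l, r) \<in># ordered_splits M. image_mset (\<lambda>l'. (l', r)) (replace_one g l) + image_mset (\<lambda>r'. (l, r')) (replace_one g r))"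
proof (induction M)
  case empty
  show ?case by (simp add: ordered_splits_empty)
next
  case (add m M)
  let ?L = "image_mset (\<lambda>(l, r). (add_mset m l, r))" and ?R = "image_mset (\<lambda>(l, r). (l, add_mset m r))"
  have "(\<Sum>N \<in># replace_one g (add_mset m M). ordered_splits N) =
     (\<Sum>m' \<in># g m. image_mset (\<lambda>(l, r). (add_mset m' l, r)) (ordered_splits M)) +
     (\<Sum>m' \<in># g m. image_mset (\<lambda>(l, r). (l, add_mset m' r)) (ordered_splits M)) +
     (?L (\<Sum>N \<in># replace_one g M. ordered_splits N) + ?R (\<Sum>N \<in># replace_one g M. ordered_splits N))"
    by (simp add: replace_one_add_mset ordered_splits_add_mset multiset_sum_simps add_ac)
  then show ?case unfolding add
    by (simp add: replace_one_add_mset ordered_splits_add_mset multiset_sum_simps case_prod_unfold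
        image_mset.compositionality comp_def sum_mset_image_mset_swap[of _ _ "g m"] add_ac)
qed

text \<open>The representative underlying the coset \<open>gl_comult a\<close>.\<close>

definition split_sum :: "'k::field tree_space \<Rightarrow> ('k tree_space \<times> 'k tree_space \<Rightarrow>\<^sub>0 'k)" where
  "split_sum = lin_ext (\<lambda>t. \<Sum>(l, r) \<in># ordered_splits (children t). bas (bas (Node l), bas (Node r)))"

lemma gl_comult_split_sum: "gl_comult a = tensor_class pscale pscale (split_sum a)"
  by (simp add: gl_comult_def split_sum_def)

lemma split_sum_simps:
  "split_sum (x + y) = split_sum x + split_sum y"
  "split_sum (pscale c x) = pscale c (split_sum x)"
  "split_sum 0 = 0"
  "split_sum (\<Sum>i \<in># I. f i) = (\<Sum>i \<in># I. split_sum (f i))"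
  by (simp_all add: split_sum_def lin_ext_add lin_ext_scale lin_ext_sum_mset)

lemma split_sum_bas:
  "split_sum (bas (Node M)) = (\<Sum>(l, r) \<in># ordered_splits M. bas (bas (Node l), bas (Node r)))"
  by (simp add: split_sum_def)

lemma lookup_sum_mset_bas: "Poly_Mapping.lookup (\<Sum>x \<in># M. bas (g x)) y = of_nat (count (image_mset g M) y)"
  by (induction M) (auto simp: lookup_add lookup_bas)

text \<open>A split \<open>(l, r)\<close> arises from the multiset \<open>l + r\<close> only, so
  just one coefficient of \<open>a\<close> is involved.\<close>

lemma lookup_tensor_coeffs_split_sum:
  "Poly_Mapping.lookup (tensor_coeffs (split_sum a)) (Node l, Node r) =
     Poly_Mapping.lookup a (Node (l + r)) * of_nat (count (ordered_splits (l + r)) (l, r))"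
  for a :: "'k::field tree_space"
proof (induction a rule: basis_induct)
  case (scale c t)
  obtain M where t: "t = Node M" by (cases t)
  have inj: "inj (\<lambda>(l, r). (Node l, Node r))" by (auto simp: inj_def)
  have "Poly_Mapping.lookup (tensor_coeffs (split_sum (bas t :: 'k tree_space))) (Node l, Node r) =
      of_nat (count (image_mset (\<lambda>(l, r). (Node l, Node r)) (ordered_splits M)) ((\<lambda>(l, r). (Node l, Node r)) (l, r)))"
    by (simp add: t split_sum_bas tensor_coeffs_simps case_prod_unfold tensor_coeffs_bas bilin_ext_bas lookup_sum_mset_bas)
  also have "\<dots> = of_nat (count (ordered_splits M) (l, r))"
    unfolding count_image_mset_inj[OF inj] ..
  also have "\<dots> = (if M = l + r then of_nat (count (ordered_splits (l + r)) (l, r)) else 0)"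
  proof -
    have "count (ordered_splits M) (l, r) = 0" if "M \<noteq> l + r"
      using that ordered_splits_union by (metis not_in_iff)
    then show ?thesis by simp
  qed
  finally show ?case
    by (cases "M = l + r") (simp_all add: t split_sum_simps tensor_coeffs_simps lookup_bas)
qed (simp_all add: split_sum_simps tensor_coeffs_simps lookup_add distrib_right)

lemma lookup_tensor_coeffs_left:
  "Poly_Mapping.lookup (tensor_coeffs (bas (bas u, a))) (x, y) = (if x = u then Poly_Mapping.lookup a y else 0)"
  and lookup_tensor_coeffs_right:
  "Poly_Mapping.lookup (tensor_coeffs (bas (a, bas u))) (x, y) = (if y = u then Poly_Mapping.lookup a x else 0)"
  by (induction a rule: basis_induct;
      auto simp: tensor_coeffs_bas bilin_ext_simps bilin_ext_bas lookup_add lookup_bas)+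

lemma plant_sum: "plant (\<Sum>x \<in> A. f x) = (\<Sum>x \<in> A. plant (f x))"
  by (simp add: plant_def lin_ext_sum)

lemma lin_ext_bas_id: "lin_ext bas a = (a :: 'a \<Rightarrow>\<^sub>0 'k::field)"
  by (induction a rule: basis_induct) (simp_all add: lin_ext_add lin_ext_scale)

text \<open>If the root of a tree in the support has a child \<open>s\<close> and further children
  \<open>r\<close>, its coproduct has a positive coefficient at \<open>({#s#}, r)\<close>, where a
  primitive element has coefficient 0.\<close>

lemma primitives_gl_hopf: "primitives (gl_hopf :: ('k::field_char_0, _) hopf_data) = range plant"
proof
  show "range plant \<subseteq> primitives (gl_hopf :: ('k, _) hopf_data)"
  proof safe
    fix x :: "'k tree_space"
    have "tensor_coeffs (split_sum (plant x)) = tensor_coeffs (bas (bas \<e>, plant x) + bas (plant x, bas \<e>))"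
      by (induction x rule: basis_induct)
        (simp_all add: plant_simps plant_bas split_sum_simps split_sum_bas tensor_coeffs_simps tensor_coeffs_bas
          ordered_splits_single bilin_ext_simps bilin_ext_bas pscale.scale_right_distrib add_ac)
    then show "plant x \<in> primitives gl_hopf"
      by (simp add: primitives_def gl_hopf_def gl_comult_split_sum tensor_class_eq_iff_coeffs)
  qed
  show "primitives (gl_hopf :: ('k, _) hopf_data) \<subseteq> range plant"
  proof
    fix a :: "'k tree_space" assume "a \<in> primitives gl_hopf"
    then have "tensor_coeffs (split_sum a) = tensor_coeffs (bas (bas \<e>, a) + bas (a, bas \<e>))"
      by (simp add: primitives_def gl_hopf_def gl_comult_split_sum tensor_class_eq_iff_coeffs)
    then have coeff: "Poly_Mapping.lookup a (Node (l + r)) * of_nat (count (ordered_splits (l + r)) (l, r)) =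
        (if l = {#} then Poly_Mapping.lookup a (Node r) else 0) + (if r = {#} then Poly_Mapping.lookup a (Node l) else 0)" for l r
      unfolding lookup_tensor_coeffs_split_sum[symmetric]
      by (simp add: tensor_coeffs_simps lookup_add lookup_tensor_coeffs_left lookup_tensor_coeffs_right)
    have "\<exists>s. t = Node {#s#}" if "t \<in> Poly_Mapping.keys a" for t
    proof -
      have nz: "Poly_Mapping.lookup a t \<noteq> 0" using that by (simp add: in_keys_iff)
      obtain M where t: "t = Node M" by (cases t)
      \<comment> \<open>At the pair of empty forests the coefficient of the single vertex equals
        twice itself, so it vanishes.\<close>
      have "M \<noteq> {#}" using coeff[of "{#}" "{#}"] nz by (auto simp: t ordered_splits_empty)
      then obtain s r where M: "M = add_mset s r" using multiset_cases by blast
      have "count (ordered_splits ({#s#} + r)) ({#s#}, r) \<noteq> 0"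
        using ordered_splits_mem[of "{#s#}" r] by (metis not_in_iff)
      then have "Poly_Mapping.lookup a t * of_nat (count (ordered_splits ({#s#} + r)) ({#s#}, r)) \<noteq> 0"
        using nz by (simp only: mult_eq_0_iff of_nat_eq_0_iff simp_thms)
      moreover have "Poly_Mapping.lookup a t * of_nat (count (ordered_splits ({#s#} + r)) ({#s#}, r)) = 0"
        if "r \<noteq> {#}"
        using coeff[of "{#s#}" r] that by (simp add: t M)
      ultimately have "r = {#}" by blast
      then show ?thesis using t M by simp
    qed
    then obtain b where b: "\<And>t. t \<in> Poly_Mapping.keys a \<Longrightarrow> t = Node {#b t#}" by metis
    have "a = lin_ext bas a" by (simp add: lin_ext_bas_id)
    also have "\<dots> = lin_ext (\<lambda>t. plant (pscale (of_nat (symmetries (b t))) (bas (b t)))) a"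
      unfolding lin_ext_def plant_scaled_bas by (intro sum.cong refl arg_cong2[where f = pscale] arg_cong[where f = bas] b)
    also have "\<dots> = plant (lin_ext (\<lambda>t. pscale (of_nat (symmetries (b t))) (bas (b t))) a)"
      by (simp only: lin_ext_def[where p = a] plant_sum plant_simps)
    finally show "a \<in> range plant" by blast
  qed
qed

lemma inj_plant: "inj (plant :: 'k::field_char_0 tree_space \<Rightarrow> _)"
proof (rule inj_on_inverseI)
  \<comment> \<open>A left inverse of \<open>plant\<close>; only its values at planted trees, where
    \<open>the_elem\<close> finds the unique child, matter.\<close>
  define g :: "rtree \<Rightarrow> 'k tree_space" where
    "g t = (let s = the_elem (set_mset (children t)) in pscale (of_nat (symmetries s)) (bas s))" for t
  show "lin_ext g (plant x) = x" for x
    by (induction x rule: basis_induct)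
      (simp_all add: plant_simps plant_bas lin_ext_add lin_ext_scale g_def symmetries_neq_0)
qed

lemma lie_isomorphism_plant: "lie_isomorphism ck_lie (primitive_lie (gl_hopf :: ('k::field_char_0, _) hopf_data)) plant"
proof -
  have "bij_betw plant UNIV (primitives (gl_hopf :: ('k, _) hopf_data))"
    unfolding primitives_gl_hopf by (rule inj_on_imp_bij_betw[OF inj_plant])
  then show ?thesis
    by (simp add: lie_isomorphism_def ck_lie_def primitive_lie_def plant_simps plant_bracket)
      (simp add: gl_hopf_def)
qed

text \<open>Left multiplication by a primitive element is a coderivation: grafting at the root puts
  \<open>s\<close> into either half of a split, and grafting elsewhere is covered by
  \<open>ordered_splits_replace_one\<close>.\<close>

lemma split_sum_gl_mult_plant:
  "tensor_coeffs (split_sum (gl_mult (plant x) a)) =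
     tensor_coeffs (lin_ext (\<lambda>(b, c). bas (gl_mult (plant x) b, c) + bas (b, gl_mult (plant x) c)) (split_sum a))"
  for x :: "'k::field_char_0 tree_space"
proof -
  have 1: "tensor_coeffs (split_sum (gl_mult (bas (Node {#s#})) (bas (Node M)))) =
     (tensor_coeffs (lin_ext (\<lambda>(b, c). bas (gl_mult (bas (Node {#s#})) b, c) + bas (b, gl_mult (bas (Node {#s#})) c))
       (split_sum (bas (Node M)))) :: _ \<Rightarrow>\<^sub>0 'k)" for s M
  proof -
    have "(\<Sum>t \<in># graft s (Node M). ordered_splits (children t)) = 
       (\<Sum>(l, r) \<in># ordered_splits M. image_mset (\<lambda>t. (children t, r)) (graft s (Node l)) + image_mset (\<lambda>t. (l, children t)) (graft s (Node r)))"
      by (simp add: graft_Node multiset_sum_simps ordered_splits_add_mset ordered_splits_replace_one case_prod_unfold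
          image_mset.compositionality comp_def add_ac)
    from arg_cong[OF this, of "\<lambda>P. \<Sum>(l, r) \<in># P. bas (Node l, Node r) :: _ \<Rightarrow>\<^sub>0 'k"]
    show ?thesis
      by (simp add: gl_mult_bas_graft split_sum_simps split_sum_def tensor_coeffs_simps lin_ext_sum_mset tensor_coeffs_bas
          bilin_ext_bas bilin_ext_simps case_prod_unfold multiset_sum_simps lin_ext_add image_mset.compositionality comp_def)
  qed
  have 2: "tensor_coeffs (split_sum (gl_mult (bas (Node {#s#})) a)) =
     tensor_coeffs (lin_ext (\<lambda>(b, c). bas (gl_mult (bas (Node {#s#})) b, c) + bas (b, gl_mult (bas (Node {#s#})) c)) (split_sum a))" for s
  proof (induction a rule: basis_induct)
    case (scale c t)
    show ?case using 1[of s "children t"]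
      by (simp add: gl_mult_simps split_sum_simps tensor_coeffs_simps lin_ext_scale)
  qed (simp_all add: gl_mult_simps split_sum_simps tensor_coeffs_simps lin_ext_add)
  \<comment> \<open>Linearity in the primitive element holds in coordinates, since pairs of vectors
    in the free space are not bilinear.\<close>
  have lin: "tensor_coeffs (lin_ext (\<lambda>(b, c). bas (gl_mult (y + z) b, c) + bas (b, gl_mult (y + z) c)) w) =
     tensor_coeffs (lin_ext (\<lambda>(b, c). bas (gl_mult y b, c) + bas (b, gl_mult y c)) w) +
     tensor_coeffs (lin_ext (\<lambda>(b, c). bas (gl_mult z b, c) + bas (b, gl_mult z c)) w)"
    "tensor_coeffs (lin_ext (\<lambda>(b, c). bas (gl_mult (pscale k y) b, c) + bas (b, gl_mult (pscale k y) c)) w) =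
     pscale k (tensor_coeffs (lin_ext (\<lambda>(b, c). bas (gl_mult y b, c) + bas (b, gl_mult y c)) w))"
    "tensor_coeffs (lin_ext (\<lambda>(b, c). bas (gl_mult 0 b, c) + bas (b, gl_mult 0 c)) w) = 0"
    for y z k and w :: "'k tree_space \<times> 'k tree_space \<Rightarrow>\<^sub>0 'k"
    by (induction w rule: basis_induct;
        auto simp: tensor_coeffs_simps lin_ext_add lin_ext_scale gl_mult_simps tensor_coeffs_bas bilin_ext_simps
          pscale.scale_right_distrib mult.commute add_ac)+
  show ?thesis
    by (induction x rule: basis_induct)
      (simp_all only: plant_simps plant_bas lin, simp_all add: gl_mult_simps split_sum_simps tensor_coeffs_simps 2)
qed

section \<open>The map to the enveloping algebra\<close>

lemma gl_mult_bas_Node: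
  "gl_mult (bas (Node {#s#})) (bas (Node M)) =
     bas (Node (add_mset s M)) + (\<Sum>N \<in># replace_one (graft s) M. bas (Node N) :: 'k::field tree_space)"
  by (simp add: gl_mult_bas_graft graft_Node image_mset.compositionality comp_def)

text \<open>Planted trees generate: by \<open>gl_mult_bas_Node\<close>,
  \<open>Node (add_mset s K)\<close> is \<open>B s\<close> times \<open>Node K\<close> minus trees
  with fewer children at the root.\<close>

lemma gl_induct [case_names unit add scale plant]:
  fixes a :: "'k::field_char_0 tree_space"
  assumes unit: "P (bas \<e>)" and add: "\<And>a b. P a \<Longrightarrow> P b \<Longrightarrow> P (a + b)" and scale: "\<And>c a. P a \<Longrightarrow> P (pscale c a)"
    and plant: "\<And>x a. P a \<Longrightarrow> P (gl_mult (plant x) a)"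
  shows "P a"
proof -
  have zero: "P 0" using scale[OF unit, of 0] by simp
  have diff: "P (a - b)" if "P a" "P b" for a b
    using add[OF that(1) scale[OF that(2), of "- 1"]] by simp
  have "P (bas (Node M))" for M
  proof (induction M rule: measure_induct_rule[of size])
    case (less M)
    show ?case
    proof (cases M)
      case (add s K)
      have "P (\<Sum>N \<in># Q. bas (Node N))" if "\<And>N. N \<in># Q \<Longrightarrow> P (bas (Node N))" for Q
        using that by (induction Q) (auto intro: zero assms(2))
      note sum = this
      have d: "P (\<Sum>N \<in># replace_one (graft s) K. bas (Node N))"
        by (rule sum, rule less.IH) (simp add: add size_replace_one)
      have "P (gl_mult (plant (pscale (of_nat (symmetries s)) (bas s))) (bas (Node K)))"
        by (rule plant, rule less.IH) (simp add: add)
      from diff[OF this d] show ?thesis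
        by (simp add: add plant_scaled_bas gl_mult_bas_Node)
    qed (simp add: unit)
  qed
  then have "P (bas t)" for t by (cases t) simp
  then show ?thesis by (induction a rule: basis_induct) (auto intro: zero add scale)
qed

text \<open>A word for \<open>Node M\<close>, obtained by solving \<open>gl_mult_bas_Node\<close>
  for its leading term. The recursion is on a number, intended to be \<open>size M\<close>, because
  \<open>replace_one\<close> changes the multiset but keeps its size.\<close>

primrec node_word :: "nat \<Rightarrow> rtree multiset \<Rightarrow> ('k::field tree_space list \<Rightarrow>\<^sub>0 'k)" where
  "node_word 0 M = 1"
| "node_word (Suc n) M =
     (let s = SOME s. s \<in># M; K = M - {#s#} in
       letter (pscale (of_nat (symmetries s)) (bas s)) * node_word n K -
       (\<Sum>N \<in># replace_one (graft s) K. node_word n N))"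

definition gl_word :: "'k::field tree_space \<Rightarrow> ('k tree_space list \<Rightarrow>\<^sub>0 'k)" where
  "gl_word = lin_ext (\<lambda>t. node_word (size (children t)) (children t))"

definition gl_env :: "'k::field tree_space \<Rightarrow> 'k ck_env" where
  "gl_env a = abs_ck_env (gl_word a)"

lemma gl_word_simps:
  "gl_word (a + b) = gl_word a + gl_word b" "gl_word (a - b) = gl_word a - gl_word b"
  "gl_word (pscale c a) = pscale c (gl_word a)" "gl_word 0 = 0"
  "gl_word (\<Sum>i \<in># I. g i) = (\<Sum>i \<in># I. gl_word (g i))"
  by (simp_all add: gl_word_def lin_ext_add lin_ext_diff lin_ext_scale lin_ext_sum_mset)

lemma gl_env_simps:
  "gl_env (a + b) = gl_env a + gl_env b" "gl_env (a - b) = gl_env a - gl_env b"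
  "gl_env (pscale c a) = ck_env_scale c (gl_env a)" "gl_env 0 = 0"
  by (simp_all add: gl_env_def gl_word_simps plus_ck_env.abs_eq minus_ck_env.abs_eq ck_env_scale.abs_eq zero_ck_env.abs_eq)

lemma gl_env_unit: "gl_env (bas \<e>) = 1"
  by (simp add: gl_env_def gl_word_def one_ck_env.abs_eq)

text \<open>For the child chosen by the recursion, the intertwining property is the recursion
  itself; the statement hides the choice.\<close>

lemma gl_env_Node:
  assumes "M \<noteq> {#}"
  obtains s K where "M = add_mset s K"
    "gl_env (gl_mult (bas (Node {#s#})) (bas (Node K))) =
       abs_ck_env (letter (pscale (of_nat (symmetries s)) (bas s))) * (gl_env (bas (Node K)) :: 'k::field ck_env)"
proof -
  define s where "s = (SOME s. s \<in># M)"
  define K where "K = M - {#s#}"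
  have "s \<in># M" unfolding s_def by (rule someI_ex) (use assms in auto)
  then have M: "M = add_mset s K" by (simp add: K_def)
  have "gl_word (bas (Node M)) = letter (pscale (of_nat (symmetries s)) (bas s)) * gl_word (bas (Node K)) -
      (\<Sum>N \<in># replace_one (graft s) K. gl_word (bas (Node N)) :: _ \<Rightarrow>\<^sub>0 'k)"
  proof -
    have "(\<Sum>N \<in># replace_one (graft s) K. node_word (size K) N :: _ \<Rightarrow>\<^sub>0 'k) =
        (\<Sum>N \<in># replace_one (graft s) K. node_word (size N) N)"
      by (intro arg_cong[where f = sum_mset] image_mset_cong) (simp add: size_replace_one)
    moreover have "size M = Suc (size K)" by (simp add: M)
    ultimately show ?thesis by (simp add: gl_word_def Let_def flip: s_def K_def)
  qed
  then have "gl_env (gl_mult (bas (Node {#s#})) (bas (Node K))) =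
      abs_ck_env (letter (pscale (of_nat (symmetries s)) (bas s))) * (gl_env (bas (Node K)) :: 'k ck_env)"
    by (simp add: gl_mult_bas_Node gl_env_def gl_word_simps times_ck_env.abs_eq flip: M)
  with M show ?thesis by (rule that)
qed

lemma abs_ck_env_bracket:
  "abs_ck_env (letter (ck_bracket x y)) =
     abs_ck_env (letter x) * abs_ck_env (letter y) - abs_ck_env (letter y) * abs_ck_env (letter x)"
  by (simp add: ck_env_relations(3)[of x y])

text \<open>Induction on the number of children of the root. If the recursion for
  \<open>add_mset s M\<close> splits off \<open>s\<close>, nothing is left to do; if it splits off
  another child, a Lie relation exchanges the two letters.\<close>

lemma gl_env_plant: "gl_env (gl_mult (plant x) a) = abs_ck_env (letter x) * gl_env a"
  for x a :: "'k::field_char_0 tree_space"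
proof -
  define y :: "rtree \<Rightarrow> 'k tree_space" where "y s = pscale (of_nat (symmetries s)) (bas s)" for s
  have plant_y: "plant (y s) = bas (Node {#s#})" for s
    by (simp add: y_def plant_scaled_bas)
  let ?X = "\<lambda>x :: 'k tree_space. abs_ck_env (letter x)"
  have letter_0: "?X 0 = 0"
    using ck_env_relations(1)[of 0 0] by simp
  \<comment> \<open>By linearity it suffices to treat the rescaled letters \<open>y s\<close>, whose
    planted images are single trees.\<close>
  have letters: "gl_env (gl_mult (plant x) a) = ?X x * gl_env a"
    if "\<And>s. gl_env (gl_mult (plant (y s)) a) = ?X (y s) * gl_env a" for x a
  proof (induction x rule: basis_induct)
    case (scale c t)
    have "pscale c (bas t) = pscale (c * inverse (of_nat (symmetries t))) (y t)"
      by (simp add: y_def symmetries_neq_0)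
    then show ?case
      using that[of t]
      by (simp only: plant_simps gl_mult_simps gl_env_simps ck_env_relations ck_env_scale_mult_left)
  qed (simp_all add: plant_simps gl_mult_simps gl_env_simps ck_env_relations distrib_right letter_0)
  have vectors: "gl_env (gl_mult (plant x) (\<Sum>N \<in># Q. bas (Node N))) = ?X x * gl_env (\<Sum>N \<in># Q. bas (Node N))"
    if "\<And>N. N \<in># Q \<Longrightarrow> gl_env (gl_mult (plant x) (bas (Node N))) = ?X x * gl_env (bas (Node N))" for x Q
    using that by (induction Q) (simp_all add: gl_mult_simps gl_env_simps distrib_left)
  have nodes: "gl_env (gl_mult (plant x) (bas (Node M))) = ?X x * gl_env (bas (Node M))" for x M
  proof (induction M arbitrary: x rule: measure_induct_rule[of size])
    case (less M)
    have "gl_env (gl_mult (plant (y s)) (bas (Node M))) = ?X (y s) * gl_env (bas (Node M))" for s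
    proof -
      obtain s0 K0 where K0: "add_mset s M = add_mset s0 K0"
        and "gl_env (gl_mult (bas (Node {#s0#})) (bas (Node K0))) =
          ?X (pscale (of_nat (symmetries s0)) (bas s0)) * gl_env (bas (Node K0))"
        by (rule gl_env_Node[of "add_mset s M", where 'k = 'k]) auto
      then have eq0: "gl_env (gl_mult (plant (y s0)) (bas (Node K0))) = ?X (y s0) * gl_env (bas (Node K0))"
        unfolding plant_y unfolding y_def by simp
      show ?thesis
      proof (cases "s = s0")
        case True
        then show ?thesis using K0 eq0 by simp
      next
        case False
        then obtain K where K: "M = add_mset s0 K" "K0 = add_mset s K"
          using K0 by (auto simp: add_eq_conv_ex)
        define k where "k = (bas (Node K) :: 'k tree_space)"
        define d where "d s = (\<Sum>N \<in># replace_one (graft s) K. bas (Node N) :: 'k tree_space)" for s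
        have k: "gl_env (gl_mult (plant x) k) = ?X x * gl_env k" for x
          unfolding k_def by (rule less.IH) (simp add: K)
        have d: "gl_env (gl_mult (plant x) (d s)) = ?X x * gl_env (d s)" for x s
          unfolding d_def by (rule vectors, rule less.IH) (auto simp: K size_replace_one)
        have M: "bas (Node M) = gl_mult (plant (y s0)) k - d s0" and K0: "bas (Node K0) = gl_mult (plant (y s)) k - d s"
          by (simp_all add: k_def d_def plant_y gl_mult_bas_Node K)
        \<comment> \<open>The choice of \<open>s0\<close> settles this order of the two letters; the
          remainder \<open>d s\<close> has fewer children at the root than \<open>M\<close>.\<close>
        have swap: "?X (y s0) * (?X (y s) * gl_env k) = gl_env (gl_mult (plant (y s0)) (gl_mult (plant (y s)) k))"
          using eq0 unfolding K0 by (simp add: gl_mult_simps gl_env_simps d k right_diff_distrib)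
        \<comment> \<open>The other order differs by a bracket acting on \<open>k\<close>. The
          induction hypothesis covers it because it holds for every \<open>x\<close>, not only for
          the letters \<open>y s\<close>.\<close>
        have "?X (y s) * (?X (y s0) * gl_env k) =
            ?X (ck_bracket (y s) (y s0)) * gl_env k + ?X (y s0) * (?X (y s) * gl_env k)"
          by (simp add: abs_ck_env_bracket left_diff_distrib mult.assoc)
        also have "\<dots> = gl_env (gl_mult (plant (y s)) (gl_mult (plant (y s0)) k))"
          unfolding swap unfolding k[symmetric]
          by (simp add: plant_bracket gl_mult_simps gl_env_simps gl_mult_plant_assoc)
        finally show ?thesis
          unfolding M by (simp add: gl_mult_simps gl_env_simps d k right_diff_distrib)
      qed
    qed
    then show ?case by (rule letters)
  qed
  show ?thesis
  proof (induction a rule: basis_induct)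
    case (scale c t)
    then show ?case
      using nodes[of x "children t"] by (simp add: gl_mult_simps gl_env_simps ck_env_scale_mult_right)
  qed (simp_all add: gl_mult_simps gl_env_simps distrib_left)
qed

section \<open>Multiplicativity and bijectivity\<close>

lemma gl_env_mult: "gl_env (gl_mult a b) = gl_env a * gl_env b"
  for a b :: "'k::field_char_0 tree_space"
proof (induction a rule: gl_induct)
  case (plant x a)
  then show ?case
    unfolding gl_mult_plant_assoc[symmetric] gl_env_plant by (simp add: mult.assoc)
qed (simp_all add: gl_mult_simps gl_env_simps gl_mult_unit gl_env_unit distrib_right ck_env_scale_mult_left)

text \<open>The free algebra acts on the space of trees, a letter \<open>x\<close> by left
  multiplication with \<open>plant x\<close>. Applying a word to the unit will invert
  \<open>gl_env\<close>.\<close>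

definition word_action :: "('k::field_char_0 tree_space list \<Rightarrow>\<^sub>0 'k) \<Rightarrow> 'k tree_space \<Rightarrow> 'k tree_space" where
  "word_action p a = lin_ext (\<lambda>w. foldr (\<lambda>x. gl_mult (plant x)) w a) p"

lemma word_action_simps:
  "word_action (p + q) a = word_action p a + word_action q a"
  "word_action (p - q) a = word_action p a - word_action q a"
  "word_action (pscale c p) a = pscale c (word_action p a)"
  "word_action 0 a = 0"
  by (simp_all add: word_action_def lin_ext_add lin_ext_diff lin_ext_scale)

lemma word_action_bas: "word_action (bas w) a = foldr (\<lambda>x. gl_mult (plant x)) w a"
  by (simp add: word_action_def)

lemma word_action_linear:
  "word_action p (a + b) = word_action p a + word_action p b"
  "word_action p (pscale c a) = pscale c (word_action p a)"
  "word_action p 0 = 0"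
proof -
  have w: "word_action (bas w) (a + b) = word_action (bas w) a + word_action (bas w) b"
    "word_action (bas w) (pscale c a) = pscale c (word_action (bas w) a)"
    "word_action (bas w) 0 = 0" for w
    by (induction w) (simp_all add: word_action_bas gl_mult_simps)
  show "word_action p (a + b) = word_action p a + word_action p b"
    "word_action p (pscale c a) = pscale c (word_action p a)" "word_action p 0 = 0"
    by (induction p rule: basis_induct;
        simp add: word_action_simps w pscale.scale_right_distrib mult.commute add_ac)+
qed

lemma word_action_mult: "word_action (p * q) a = word_action p (word_action q a)"
proof (induction p rule: basis_induct)
  case (scale c u)
  have "word_action (bas u * q) a = word_action (bas u) (word_action q a)"
    by (induction q rule: basis_induct)
      (simp_all add: distrib_left pscale_mult_right word_action_simps word_action_linear bas_mult plus_list_def word_action_bas)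
  then show ?case by (simp add: pscale_mult_left word_action_simps)
qed (simp_all add: distrib_right word_action_simps)

text \<open>The action descends to the enveloping algebra: \<open>plant\<close> respects brackets,
  and associativity turns a commutator into a commutator of operators.\<close>

lemma word_action_cong:
  assumes "abs_ck_env p = abs_ck_env q"
  shows "word_action p a = word_action q a"
proof -
  have rel: "word_action s a = 0" if "s \<in> enveloping_relations pscale ck_bracket" for s a
    using that unfolding enveloping_relations_def
    by (auto simp: word_action_simps word_action_mult word_action_bas plant_simps gl_mult_simps plant_bracket gl_mult_plant_assoc)
  have "p - q \<in> two_sided_ideal (enveloping_relations pscale ck_bracket)"
    using assms by (simp add: ck_env.abs_eq_iff ck_env_equiv_def enveloping_ideal_def)
  then have "word_action (p - q) a = 0"
    by induction (simp_all add: word_action_simps word_action_mult rel word_action_linear)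
  then show ?thesis by (simp add: word_action_simps)
qed

lemma word_action_gl_word: "word_action (gl_word a) (bas \<e>) = a"
  for a :: "'k::field_char_0 tree_space"
proof (induction a rule: gl_induct)
  case unit
  have "gl_word (bas \<e>) = (bas [] :: _ \<Rightarrow>\<^sub>0 'k)"
    by (simp add: gl_word_def) (simp add: bas_def flip: zero_list_def)
  then show ?case by (simp add: word_action_bas)
next
  case (plant x a)
  have "abs_ck_env (gl_word (gl_mult (plant x) a)) = abs_ck_env (letter x * gl_word a)"
    using gl_env_plant[of x a] by (simp add: gl_env_def times_ck_env.abs_eq)
  then have "word_action (gl_word (gl_mult (plant x) a)) (bas \<e>) = word_action (letter x * gl_word a) (bas \<e>)"
    by (rule word_action_cong)
  then show ?case using plant by (simp add: word_action_mult word_action_bas)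
qed (simp_all add: gl_word_simps word_action_simps)

lemma bij_gl_env: "bij (gl_env :: 'k::field_char_0 tree_space \<Rightarrow> 'k ck_env)"
proof (rule bijI)
  show "inj (gl_env :: 'k tree_space \<Rightarrow> _)"
    by (rule injI) (metis gl_env_def word_action_cong word_action_gl_word)
  \<comment> \<open>The range contains the unit and is closed under left multiplication by
    letters.\<close>
  have word: "abs_ck_env (bas w) \<in> range (gl_env :: 'k tree_space \<Rightarrow> _)" for w
  proof (induction w)
    case Nil
    show ?case by (metis abs_ck_env_bas_Nil gl_env_unit rangeI)
  next
    case (Cons x w)
    then obtain a where "abs_ck_env (bas w) = gl_env a" by blast
    then have "abs_ck_env (bas (x # w)) = gl_env (gl_mult (plant x) a)"
      using abs_ck_env_bas_append[of "[x]" w] by (simp add: gl_env_plant)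
    then show ?case by blast
  qed
  have "abs_ck_env p \<in> range (gl_env :: 'k tree_space \<Rightarrow> _)" for p
  proof (induction p rule: basis_induct)
    case zero
    show ?case by (metis gl_env_simps(4) rangeI zero_ck_env.abs_eq)
  next
    case (add p q)
    then show ?case by (metis (no_types, lifting) gl_env_simps(1) imageE plus_ck_env.abs_eq rangeI)
  next
    case (scale c w)
    show ?case using word[of w] by (metis (no_types, lifting) gl_env_simps(3) imageE ck_env_scale.abs_eq rangeI)
  qed
  then have "u \<in> range (gl_env :: 'k tree_space \<Rightarrow> _)" for u
    by (induction u rule: ck_env.abs_induct)
  then show "surj (gl_env :: 'k tree_space \<Rightarrow> _)" by blast
qed

lemma unit_notin_graft: "\<e> \<notin># graft s t"
proof -
  obtain M where t: "t = Node M" by (cases t)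
  have "{#} \<notin># replace_one (graft s) M"
    using size_replace_one[of "{#}" "graft s" M] by (cases "M = {#}") auto
  then show ?thesis by (auto simp: t graft_Node)
qed

text \<open>Both counits vanish on a left multiple of a letter or of a planted element, as grafting
  never yields the single vertex.\<close>

lemma counit_gl_env: "ck_env_counit (gl_env a) = Poly_Mapping.lookup a \<e>"
  for a :: "'k::field_char_0 tree_space"
proof (induction a rule: gl_induct)
  case (plant x a)
  have "Poly_Mapping.lookup (letter x * p) [] = 0" for p :: "'k tree_space list \<Rightarrow>\<^sub>0 'k"
    by (induction p rule: basis_induct)
      (simp_all add: distrib_left lookup_add pscale_mult_right bas_mult plus_list_def lookup_bas)
  moreover have "Poly_Mapping.lookup (gl_mult (plant x) a) \<e> = 0"
  proof -
    have st: "Poly_Mapping.lookup (gl_mult (plant (bas s)) (bas t)) \<e> = (0 :: 'k)" for s t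
      using unit_notin_graft[of s t]
      by (simp add: plant_bas gl_mult_simps gl_mult_bas_graft lookup_sum_mset_bas[where g = "\<lambda>x. x", simplified] not_in_iff)
    have s: "Poly_Mapping.lookup (gl_mult (plant (bas s)) a) \<e> = 0" for s
      by (induction a rule: basis_induct) (simp_all add: gl_mult_simps lookup_add st)
    show ?thesis
      by (induction x rule: basis_induct) (simp_all add: plant_simps gl_mult_simps lookup_add s)
  qed
  ultimately show ?case by (simp add: gl_env_plant) (simp add: gl_env_def times_ck_env.abs_eq ck_env_counit.abs_eq)
next
  case unit
  show ?case by (simp add: gl_env_unit ck_env_counit.abs_eq lookup_bas flip: abs_ck_env_bas_Nil)
qed (simp_all add: gl_env_def gl_word_simps ck_env_counit.abs_eq lookup_add)

section \<open>Compatibility with the coproducts\<close>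

definition gl_env2 :: "('k::field tree_space \<times> 'k tree_space \<Rightarrow>\<^sub>0 'k) \<Rightarrow> ('k ck_env \<times> 'k ck_env \<Rightarrow>\<^sub>0 'k)" where
  "gl_env2 = lin_ext (\<lambda>(x, y). bas (gl_env x, gl_env y))"

lemma gl_env2_simps:
  "gl_env2 (a + b) = gl_env2 a + gl_env2 b" "gl_env2 (a - b) = gl_env2 a - gl_env2 b"
  "gl_env2 (pscale c a) = pscale c (gl_env2 a)" "gl_env2 0 = 0"
  by (simp_all add: gl_env2_def lin_ext_add lin_ext_diff lin_ext_scale)

lemma gl_env2_bas: "gl_env2 (bas (x, y)) = bas (gl_env x, gl_env y)"
  by (simp add: gl_env2_def)

lemma gl_env2_span:
  "z \<in> pscale.span (bilinearity_relations pscale pscale) \<Longrightarrow> gl_env2 z \<in> ck_env_tensor_relations"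
proof (induction rule: pscale.span_induct_alt)
  case (step c r z)
  from step(1) have "gl_env2 r \<in> ck_env_tensor_relations"
    by (rule bilinearity_relations_cases)
      (simp_all add: gl_env2_simps gl_env2_bas gl_env_simps ck_env_tensor_relations)
  then show ?case
    using step by (simp add: gl_env2_simps pscale.span_add pscale.span_scale)
qed (simp add: gl_env2_simps pscale.span_zero)

text \<open>Left multiplication by the coproduct of a letter, on representatives.\<close>

definition letter_comult :: "'k::field tree_space \<Rightarrow> ('k ck_env \<times> 'k ck_env \<Rightarrow>\<^sub>0 'k) \<Rightarrow> ('k ck_env \<times> 'k ck_env \<Rightarrow>\<^sub>0 'k)" where
  "letter_comult x = lin_ext (\<lambda>(a, b). bas (abs_ck_env (letter x) * a, b) + bas (a, abs_ck_env (letter x) * b))"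

lemma letter_comult_simps:
  "letter_comult x (a + b) = letter_comult x a + letter_comult x b"
  "letter_comult x (a - b) = letter_comult x a - letter_comult x b"
  "letter_comult x (pscale c a) = pscale c (letter_comult x a)" "letter_comult x 0 = 0"
  by (simp_all add: letter_comult_def lin_ext_add lin_ext_diff lin_ext_scale)

lemma letter_comult_eq:
  "letter_comult x z = lin_ext (\<lambda>(a, b). bas (abs_ck_env (letter x) * a, 1 * b)) z +
     lin_ext (\<lambda>(a, b). bas (1 * a, abs_ck_env (letter x) * b)) z"
  by (induction z rule: basis_induct)
    (simp_all add: letter_comult_simps lin_ext_add lin_ext_scale add_ac,
      simp add: letter_comult_def case_prod_unfold pscale.scale_right_distrib)

lemma letter_comult_relations:
  "z \<in> ck_env_tensor_relations \<Longrightarrow> letter_comult x z \<in> ck_env_tensor_relations"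
  unfolding letter_comult_eq by (intro pscale.span_add ck_env_tensor_relations_mult)

lemma env_project2_letter_mult:
  "env_project2 (free_comult (letter x * p)) = letter_comult x (env_project2 (free_comult p))"
proof -
  have "free_comult (letter x * p) = bas ([x], []) * free_comult p + bas ([], [x]) * free_comult p"
    by (simp add: free_comult_mult distrib_right) (simp add: free_comult_def distrib_right)
  moreover have "env_project2 (a + b) = env_project2 a + env_project2 b" for a b :: "_ \<Rightarrow>\<^sub>0 'a"
    by (simp add: env_project2_def lin_ext_add)
  ultimately show ?thesis
    by (simp add: env_project2_mult_bas abs_ck_env_bas_Nil letter_comult_eq)
qed

lemma letter_comult_gl_env2:
  "letter_comult x (gl_env2 z) =
     gl_env2 (lin_ext (\<lambda>(b, c). bas (gl_mult (plant x) b, c) + bas (b, gl_mult (plant x) c)) z)"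
proof (induction z rule: basis_induct)
  case (scale c bc)
  show ?case
    by (cases bc) (simp add: letter_comult_def gl_env2_def gl_env_plant lin_ext_scale lin_ext_add)
qed (simp_all add: letter_comult_simps gl_env2_simps lin_ext_add)

text \<open>Both coproducts turn left multiplication by a primitive element into
  \<open>letter_comult\<close>, so they agree along \<open>gl_induct\<close>. The comparison is
  modulo the relations, as \<open>gl_env2\<close> acts on representatives.\<close>

lemma free_comult_gl_word:
  "env_project2 (free_comult (gl_word a)) - gl_env2 (split_sum a) \<in> ck_env_tensor_relations"
  for a :: "'k::field_char_0 tree_space"
proof (induction a rule: gl_induct)
  case unit
  have "gl_word (bas \<e>) = (bas [] :: _ \<Rightarrow>\<^sub>0 'k)"
    by (simp add: gl_word_def) (simp add: bas_def flip: zero_list_def)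
  moreover have "env_project2 (free_comult (bas [])) = bas (1, 1 :: 'k ck_env)"
  proof -
    have one: "(1 :: 'k tree_space list \<times> 'k tree_space list \<Rightarrow>\<^sub>0 'k) = bas ([], [])"
      by (simp add: bas_def flip: zero_list_def zero_prod_def)
    have "free_comult (bas []) = (1 :: 'k tree_space list \<times> 'k tree_space list \<Rightarrow>\<^sub>0 'k)"
      by (simp add: free_comult_def)
    then show ?thesis unfolding one by (simp add: env_project2_def abs_ck_env_bas_Nil)
  qed
  ultimately show ?case
    by (simp add: split_sum_bas ordered_splits_empty gl_env2_bas gl_env_unit pscale.span_zero)
next
  case (add a b)
  have "env_project2 (free_comult (p + q)) = env_project2 (free_comult p) + env_project2 (free_comult q)"
    for p q :: "'k tree_space list \<Rightarrow>\<^sub>0 'k"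
    by (simp add: env_project2_def free_comult_def lin_ext_add)
  then show ?case
    using pscale.span_add[OF add] by (simp add: gl_word_simps split_sum_simps gl_env2_simps add_diff_add)
next
  case (scale c a)
  have "env_project2 (free_comult (pscale c p)) = pscale c (env_project2 (free_comult p))"
    for p :: "'k tree_space list \<Rightarrow>\<^sub>0 'k"
    by (simp add: env_project2_def free_comult_def lin_ext_scale)
  then show ?case
    using pscale.span_scale[OF scale, of c]
    by (simp add: gl_word_simps split_sum_simps gl_env2_simps pscale.scale_right_diff_distrib)
next
  case (plant x a)
  let ?p = "gl_word (gl_mult (plant x) a)" and ?q = "letter x * gl_word a"
  let ?z = "lin_ext (\<lambda>(b, c). bas (gl_mult (plant x) b, c) + bas (b, gl_mult (plant x) c)) (split_sum a)"
  have "abs_ck_env ?p = abs_ck_env ?q"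
    using gl_env_plant[of x a] by (simp add: gl_env_def times_ck_env.abs_eq)
  \<comment> \<open>The two words differ in the free algebra; well-definedness of
    \<open>ck_env_comult\<close> replaces one by the other.\<close>
  then have "ck_env_comult (abs_ck_env ?p) = ck_env_comult (abs_ck_env ?q)" by (rule arg_cong)
  then have "env_project2 (free_comult ?p) - env_project2 (free_comult ?q) \<in> ck_env_tensor_relations"
    by (simp add: ck_env_comult.abs_eq tensor_class_eq_iff)
  moreover have "env_project2 (free_comult ?q) - gl_env2 ?z \<in> ck_env_tensor_relations"
    using letter_comult_relations[OF plant, of x]
    by (simp add: letter_comult_simps env_project2_letter_mult letter_comult_gl_env2)
  \<comment> \<open>The coderivation property says that this difference has zero coordinates, hence
    lies in the span of the relations, which \<open>gl_env2\<close> respects.\<close>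
  moreover have "gl_env2 (?z - split_sum (gl_mult (plant x) a)) \<in> ck_env_tensor_relations"
    by (rule gl_env2_span) (simp add: tensor_coeffs_simps split_sum_gl_mult_plant flip: tensor_coeffs_eq_0_iff)
  ultimately have "(env_project2 (free_comult ?p) - env_project2 (free_comult ?q)) +
      ((env_project2 (free_comult ?q) - gl_env2 ?z) + gl_env2 (?z - split_sum (gl_mult (plant x) a)))
      \<in> ck_env_tensor_relations"
    by (intro pscale.span_add)
  then show ?case by (simp add: gl_env2_simps)
qed

lemma ck_env_hopf_sel:
  "hscale ck_env_hopf = ck_env_scale" "hmult ck_env_hopf = (*)" "hunit ck_env_hopf = 1"
  "hcomult ck_env_hopf = ck_env_comult" "hcounit ck_env_hopf = ck_env_counit"
  by (simp_all add: ck_env_hopf_def)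

text \<open>All cosets in the union coincide, and the union is nonempty because \<open>z\<close>
  represents its own class.\<close>

lemma tensor_map2_gl_env:
  "tensor_map2 ck_env_hopf gl_env (tensor_class pscale pscale z) = tensor_class ck_env_scale ck_env_scale (gl_env2 z)"
proof -
  have "tensor_class ck_env_scale ck_env_scale (gl_env2 p) = tensor_class ck_env_scale ck_env_scale (gl_env2 z)"
    if "p \<in> tensor_class pscale pscale z" for p
    using that gl_env2_span[of "p - z"] by (simp add: tensor_class_def[of pscale] tensor_class_eq_iff gl_env2_simps)
  moreover have "z \<in> tensor_class pscale pscale z"
    by (simp add: tensor_class_def pscale.span_zero)
  moreover have "tensor_map2 ck_env_hopf gl_env (tensor_class pscale pscale z) =
      (\<Union>p \<in> tensor_class pscale pscale z. tensor_class ck_env_scale ck_env_scale (gl_env2 p))"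
    by (simp add: tensor_map2_def ck_env_hopf_sel gl_env2_def)
  ultimately show ?thesis by blast
qed

lemma hopf_isomorphism_gl_env: "hopf_isomorphism (gl_hopf :: ('k::field_char_0, _) hopf_data) ck_env_hopf gl_env"
proof -
  have "ck_env_comult (gl_env x) = tensor_map2 ck_env_hopf gl_env (gl_comult x)" for x :: "'k tree_space"
    using free_comult_gl_word[of x]
    by (simp add: gl_comult_split_sum tensor_map2_gl_env tensor_class_eq_iff)
      (simp add: gl_env_def ck_env_comult.abs_eq tensor_class_eq_iff)
  then show ?thesis
    unfolding hopf_isomorphism_def
    by (simp add: bij_gl_env gl_env_simps gl_env_mult gl_env_unit counit_gl_env
        gl_hopf_def ck_env_hopf_sel)
qed

theorem proposition2p1:
  shows "lie_isomorphic (ck_lie :: ('k::field_char_0, 'k tree_space) lie_data) (primitive_lie gl_hopf) \<and>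
         hopf_isomorphic (gl_hopf :: ('k, 'k tree_space) hopf_data) ck_env_hopf"
  unfolding lie_isomorphic_def hopf_isomorphic_def
  using lie_isomorphism_plant hopf_isomorphism_gl_env by blast

end
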